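(* Let $M$ be either a local model (i.e. $M=L\subset\mathbb{R}^{2n+1}$ a Legendre submanifold) or a connected and simply connected quasi-Hessian manifold, and let $\mathcal{D}:M\times M\to\mathbb{R}$ be its canonical divergence. Let $p,q,r\in M$ be three distinct points such that $p$ and $q$ are joined by an $e$-curve $c_e$, $q$ and $r$ are joined by an $m$-curve $c_m$, and $c_e$ and $c_m$ are strictly orthogonal at $q$. Then $$\mathcal{D}(p,r)=\mathcal{D}(p,q)+\mathcal{D}(q,r).$$
   Context: All manifolds and maps are $C^\infty$. $\mathbb{R}^{2n+1}$ has coordinates $(\boldsymbol{x},\boldsymbol{p},z)$ with $\boldsymbol{x},\boldsymbol{p}\in\mathbb{R}^n$ (column vectors), $z\in\mathbb{R}$, contact form $\theta=dz-\sum_i p_i\,dx_i$, and $z':=\boldsymbol{p}^T\boldsymbol{x}-z$. A Legendre submanifold is an $n$-dimensional submanifold $L$ with $\theta|_{TL}=0$. The $e$- and $m$-Lagrange maps of $L$ are $\pi^e_1:L\to\mathbb{R}^n$, $q\mapsto\boldsymbol{x}(q)$, and $\pi^m_1:L\to\mathbb{R}^n$, $q\mapsto\boldsymbol{p}(q)$. Affine Legendre equivalence: an affine map $\mathcal{L}_F(\boldsymbol{x},\boldsymbol{p},z)=(A\boldsymbol{x}+\boldsymbol{b},\,A'\boldsymbol{p}+\boldsymbol{b}',\,z+\boldsymbol{c}^T\boldsymbol{x}+d)$ with $A\in GL_n(\mathbb{R})$, $A'=(A^T)^{-1}$, $\boldsymbol{b}'=A'\boldsymbol{c}$, $\boldsymbol{b},\boldsymbol{c}\in\mathbb{R}^n$,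 $d\in\mathbb{R}$; it preserves $\theta$. Coherent tangent bundles of $L$: $E=\{(q,w)\in L\times(\mathbb{R}^n_{\boldsymbol{x}}\times\mathbb{R}_z): dz(w)-\boldsymbol{p}(q)^Td\boldsymbol{x}(w)=0\}$ and $E'=\{(q,w)\in L\times(\mathbb{R}^n_{\boldsymbol{p}}\times\mathbb{R}_{z'}): dz'(w)-\boldsymbol{x}(q)^Td\boldsymbol{p}(w)=0\}$, with bundle maps $\Phi:TL\to E$, $\Phi':TL\to E'$ the differentials of $q\mapsto(\boldsymbol{x}(q),z(q))$ and $q\mapsto(\boldsymbol{p}(q),z'(q))$, and with the flat connections $\nabla^E,\nabla^{E'}$ for which the frames $s_i=\frac{\partial}{\partial x_i}+p_i\frac{\partial}{\partial z}$ of $E$ and $s_i^*=\frac{\partial}{\partial p_i}+x_i\frac{\partial}{\partial z'}$ of $E'$ are flat. Quasi-Hessian manifold: an $n$-dimensional Hausdorff manifold $M$ obtained by gluing countably many Legendre submanifolds $L_\alpha\subset\mathbb{R}^{2n+1}$ (local models) along open subsets $L_{\alpha\beta}\subset L_\alpha$ by diffeomorphisms $\mathcal{L}_\alpha^\beta:L_{\alpha\beta}\to L_{\beta\alpha}$ which on each connected component of $L_{\alpha\beta}$ are given by an affine Legendre equivalence of $\mathbb{R}^{2n+1}$ and which satisfy $\mathcal{L}_\alpha^\gamma=\mathcal{L}_\beta^\gamma\circ\mathcal{L}_\alpha^\beta$ on $L_{\alpha\beta}\cap L_{\alpha\gamma}$ (the affine Legendre equivalences are part of the gluing data and the cocycle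 condition is understood for them). The data $(E,\nabla^E,\Phi)$, $(E',\nabla^{E'},\Phi')$ of the local models glue to data on $M$. Canonical divergence of a Legendre submanifold $L$: $\mathcal{D}_L(p,q)=z(p)+z'(q)-\boldsymbol{x}(p)^T\boldsymbol{p}(q)$, $p,q\in L$. It is invariant under affine Legendre equivalence. For a quasi-Hessian $M$, set $\mathcal{D}_M(p,q)=\mathcal{D}_{L_\alpha}(p,q)$ for $p,q$ in a common local model $L_\alpha$; this gives a function near the diagonal. If $M$ is connected and simply connected it extends to $M\times M$: continuing one local model along paths by means of the gluing affine Legendre equivalences yields a map $(\boldsymbol{x},\boldsymbol{p},z):M\to\mathbb{R}^{2n+1}$ which locally is a local model composed with an affine Legendre equivalence (unique up to a global affine Legendre equivalence), and $\mathcal{D}_M(p,q)=z(p)+z'(q)-\boldsymbol{x}(p)^T\boldsymbol{p}(q)$. $m$-curve: an immersed curve $c:I\to M$ ($I\subset\mathbb{R}$ a nonempty open interval, $\dot c(t)\neq0$) such that at every $t\in I$ the vectors $\Phi'\circ\dot c(t),\ \nabla^{E'}_{\dot c}(\Phi'\circ\dot c)(t),\ (\nabla^{E'}_{\dot c})^2(\Phi'\circ\dot c)(t),\dots$ of $E'_{c(t)}$ are not simultaneously zero and any two of them are linearly dependent. (In a local model these vectors correspond to the successive derivatives $\dot{\boldsymbol{p}}(t),\ddot{\boldsymbol{p}}(t),\dots$ of $\boldsymbol{p}(t)=\pi^m_1\circ c(t)$, and $\boldsymbol{p}(t)$ moves on a straight line in $\mathbb{R}^n_{\boldsymbol{p}}$.)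 An $e$-curve is defined in the same way with $\Phi,E,\nabla^E$ (and $\boldsymbol{x}(t)=\pi^e_1\circ c(t)$). In a local model, $\boldsymbol{m}\neq0$ denotes a direction vector of the line containing the image of an $m$-curve $c_m$ under $\pi^m_1$, and $\boldsymbol{e}\neq0$ a direction vector of the line containing the image of an $e$-curve $c_e$ under $\pi^e_1$. $c_e$ and $c_m$ are strictly orthogonal at a common point $q$ if $\boldsymbol{e}^T\boldsymbol{m}=0$, computed in a local model containing $q$; this is independent of the choices. Two points $p,q$ are joined by a curve $c:I\to M$ if there are $t_0,t_1\in I$ with $c(t_0)=p$, $c(t_1)=q$. *)

theory Defs
  imports "HOL-Analysis.Analysis"
begin

section \<open>Smooth maps and embedded Legendre submanifolds\<close>

text \<open>For open \<open>S\<close>. Continuity of the directional derivatives of order \<open>k\<close> in all directions is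
  equivalent to continuity of the \<open>k\<close>-th derivative, since the domains used below are
  finite-dimensional.\<close>

primrec Ck_on :: "nat \<Rightarrow> 'a::real_normed_vector set \<Rightarrow> ('a \<Rightarrow> 'b::real_normed_vector) \<Rightarrow> bool"
where
  "Ck_on 0 S f \<longleftrightarrow> continuous_on S f"
| "Ck_on (Suc k) S f \<longleftrightarrow> (\<forall>x\<in>S. f differentiable (at x)) \<and>
     (\<forall>v. Ck_on k S (\<lambda>x. frechet_derivative f (at x) v))"

definition smooth_on :: "'a::real_normed_vector set \<Rightarrow> ('a \<Rightarrow> 'b::real_normed_vector) \<Rightarrow> bool"
  where "smooth_on S f \<longleftrightarrow> (\<forall>k. Ck_on k S f)"

text \<open>Points \<open>(x, p, z)\<close> of the standard contact space of dimension \<open>2n+1\<close>, \<open>n = CARD('n)\<close>.\<close>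

type_synonym 'n pt = "(real^'n) \<times> (real^'n) \<times> real"

definition xc :: "'n::finite pt \<Rightarrow> real^'n" where "xc q = fst q"
definition pc :: "'n::finite pt \<Rightarrow> real^'n" where "pc q = fst (snd q)"
definition zc :: "'n::finite pt \<Rightarrow> real" where "zc q = snd (snd q)"
definition zc' :: "'n::finite pt \<Rightarrow> real" where "zc' q = pc q \<bullet> xc q - zc q"

text \<open>The value at the tangent vector \<open>v\<close> of the contact form \<open>dz - p . dx\<close> at \<open>q\<close>.\<close>

definition contact_form :: "'n::finite pt \<Rightarrow> 'n pt \<Rightarrow> real"
  where "contact_form q v = zc v - pc q \<bullet> xc v"

text \<open>An embedded smooth submanifold of dimension \<open>n\<close>, given by local parametrizations: smooth
  immersions of open sets of \<open>\<real>\<^sup>n\<close> that are homeomorphisms onto relatively open subsets.\<close>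

definition embedded_submanifold :: "'n::finite pt set \<Rightarrow> bool"
where
  "embedded_submanifold L \<longleftrightarrow>
     (\<forall>q\<in>L. \<exists>(W :: (real^'n) set) \<psi> \<phi>. open W \<and> smooth_on W \<psi> \<and>
        (\<forall>u\<in>W. inj (frechet_derivative \<psi> (at u))) \<and>
        q \<in> \<psi> ` W \<and> openin (top_of_set L) (\<psi> ` W) \<and> homeomorphism W (\<psi> ` W) \<psi> \<phi>)"

definition tangent_space :: "'n::finite pt set \<Rightarrow> 'n pt \<Rightarrow> 'n pt set"
where
  "tangent_space L q = {v. \<exists>\<gamma> \<epsilon>. \<epsilon> > 0 \<and> smooth_on {-\<epsilon><..<\<epsilon>} \<gamma> \<and> \<gamma> ` {-\<epsilon><..<\<epsilon>} \<subseteq> L \<and>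
     \<gamma> 0 = q \<and> (\<gamma> has_vector_derivative v) (at (0::real))}"

definition legendre_submanifold :: "'n::finite pt set \<Rightarrow> bool"
where
  "legendre_submanifold L \<longleftrightarrow> embedded_submanifold L \<and>
     (\<forall>q\<in>L. \<forall>v\<in>tangent_space L q. contact_form q v = 0)"

text \<open>The canonical divergence of a Legendre submanifold \<open>L\<close> is the restriction of this function
  to \<open>L \<times> L\<close>.\<close>

definition divergence :: "'n::finite pt \<Rightarrow> 'n pt \<Rightarrow> real"
  where "divergence p q = zc p + zc' q - xc p \<bullet> pc q"

definition affine_legendre :: "('n::finite pt \<Rightarrow> 'n pt) \<Rightarrow> bool"
where
  "affine_legendre F \<longleftrightarrow>
     (\<exists>(A :: real^'n^'n) b c d. invertible A \<and>
        (let A' = matrix_inv (transpose A); b' = A' *v c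
         in F = (\<lambda>q. (A *v xc q + b, A' *v pc q + b', zc q + c \<bullet> xc q + d))))"

section \<open>Coherent tangent bundles and curves in a local model\<close>

text \<open>The fibre of the bundle \<open>E\<close> at \<open>q\<close> is \<open>{(u, s). s = p(q) . u}\<close>, that of \<open>E'\<close> is
  \<open>{(u, s). s = x(q) . u}\<close>, both inside \<open>\<real>\<^sup>n \<times> \<real>\<close>; they are spanned by the frames \<open>e_frame q\<close>
  and \<open>m_frame q\<close>. The bundle maps from the tangent bundle are the differentials of \<open>e_map\<close> and
  \<open>m_map\<close>. The first components of \<open>e_map\<close> and \<open>m_map\<close> are the Lagrange maps.
  The definitions below take such a map \<open>f\<close> and frame \<open>s\<close> as parameters.\<close>

definition e_map :: "'n::finite pt \<Rightarrow> (real^'n) \<times> real" where "e_map q = (xc q, zc q)"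
definition m_map :: "'n::finite pt \<Rightarrow> (real^'n) \<times> real" where "m_map q = (pc q, zc' q)"

definition e_frame :: "'n::finite pt \<Rightarrow> 'n \<Rightarrow> (real^'n) \<times> real"
  where "e_frame q i = (axis i 1, pc q $ i)"
definition m_frame :: "'n::finite pt \<Rightarrow> 'n \<Rightarrow> (real^'n) \<times> real"
  where "m_frame q i = (axis i 1, xc q $ i)"

definition frame_coords :: "('n::finite \<Rightarrow> (real^'n) \<times> real) \<Rightarrow> (real^'n) \<times> real \<Rightarrow> real^'n"
  where "frame_coords b w = (THE a. w = (\<Sum>i\<in>UNIV. a $ i *\<^sub>R b i))"

text \<open>Covariant derivative, along the curve \<open>\<gamma>\<close>, of a section \<open>\<sigma>\<close> along \<open>\<gamma>\<close>, for the flat connection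
  whose parallel frame is \<open>s\<close>.\<close>

definition cov_deriv ::
  "('n::finite pt \<Rightarrow> 'n \<Rightarrow> (real^'n) \<times> real) \<Rightarrow> (real \<Rightarrow> 'n pt) \<Rightarrow>
   (real \<Rightarrow> (real^'n) \<times> real) \<Rightarrow> real \<Rightarrow> (real^'n) \<times> real"
where
  "cov_deriv s \<gamma> \<sigma> t =
     (\<Sum>i\<in>UNIV. vector_derivative (\<lambda>\<tau>. frame_coords (s (\<gamma> \<tau>)) (\<sigma> \<tau>)) (at t) $ i *\<^sub>R s (\<gamma> t) i)"

definition velocity_section ::
  "('n::finite pt \<Rightarrow> (real^'n) \<times> real) \<Rightarrow> (real \<Rightarrow> 'n pt) \<Rightarrow> real \<Rightarrow> (real^'n) \<times> real"
  where "velocity_section f \<gamma> t = frechet_derivative f (at (\<gamma> t)) (vector_derivative \<gamma> (at t))"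

definition nabla_jet ::
  "('n::finite pt \<Rightarrow> (real^'n) \<times> real) \<Rightarrow> ('n pt \<Rightarrow> 'n \<Rightarrow> (real^'n) \<times> real) \<Rightarrow>
   (real \<Rightarrow> 'n pt) \<Rightarrow> real \<Rightarrow> nat \<Rightarrow> (real^'n) \<times> real"
  where "nabla_jet f s \<gamma> t k = (cov_deriv s \<gamma> ^^ k) (velocity_section f \<gamma>) t"

definition line_condition :: "(nat \<Rightarrow> 'v::real_vector) \<Rightarrow> bool"
where
  "line_condition V \<longleftrightarrow> (\<exists>k. V k \<noteq> 0) \<and>
     (\<forall>j k. j \<noteq> k \<longrightarrow> (\<exists>a b :: real. (a, b) \<noteq> (0, 0) \<and> a *\<^sub>R V j + b *\<^sub>R V k = 0))"

text \<open>Here \<open>T\<close> is any open set of parameters, not necessarily an interval.\<close>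

definition straight_on ::
  "('n::finite pt \<Rightarrow> (real^'n) \<times> real) \<Rightarrow> ('n pt \<Rightarrow> 'n \<Rightarrow> (real^'n) \<times> real) \<Rightarrow>
   real set \<Rightarrow> (real \<Rightarrow> 'n pt) \<Rightarrow> bool"
where
  "straight_on f s T \<gamma> \<longleftrightarrow> smooth_on T \<gamma> \<and>
     (\<forall>t\<in>T. vector_derivative \<gamma> (at t) \<noteq> 0 \<and> line_condition (nabla_jet f s \<gamma> t))"

definition open_interval :: "real set \<Rightarrow> bool"
  where "open_interval I \<longleftrightarrow> I \<noteq> {} \<and> open I \<and> is_interval I"

definition e_curve :: "'n::finite pt set \<Rightarrow> real set \<Rightarrow> (real \<Rightarrow> 'n pt) \<Rightarrow> bool"
where
  "e_curve L I c \<longleftrightarrow> open_interval I \<and> c ` I \<subseteq> L \<and> straight_on e_map e_frame I c"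

definition m_curve :: "'n::finite pt set \<Rightarrow> real set \<Rightarrow> (real \<Rightarrow> 'n pt) \<Rightarrow> bool"
where
  "m_curve L I c \<longleftrightarrow> open_interval I \<and> c ` I \<subseteq> L \<and> straight_on m_map m_frame I c"

definition joined_by :: "real set \<Rightarrow> (real \<Rightarrow> 'a) \<Rightarrow> 'a \<Rightarrow> 'a \<Rightarrow> bool"
  where "joined_by I c p q \<longleftrightarrow> (\<exists>t0\<in>I. \<exists>t1\<in>I. c t0 = p \<and> c t1 = q)"

definition direction_vectors ::
  "('n::finite pt \<Rightarrow> (real^'n) \<times> real) \<Rightarrow> real set \<Rightarrow> (real \<Rightarrow> 'n pt) \<Rightarrow> (real^'n) set"
where
  "direction_vectors f T \<gamma> =
     {v. v \<noteq> 0 \<and> (\<exists>a. \<forall>t\<in>T. \<exists>u::real. fst (f (\<gamma> t)) = a + u *\<^sub>R v)}"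

text \<open>For an e-curve or m-curve the direction vector of the line is unique up to a nonzero factor, so
  quantifying over all direction vectors amounts to choosing one.\<close>

definition strictly_orthogonal ::
  "real set \<Rightarrow> (real \<Rightarrow> 'n::finite pt) \<Rightarrow> real set \<Rightarrow> (real \<Rightarrow> 'n pt) \<Rightarrow> 'n pt \<Rightarrow> bool"
where
  "strictly_orthogonal I ce J cm q \<longleftrightarrow> q \<in> ce ` I \<and> q \<in> cm ` J \<and>
     (\<forall>e\<in>direction_vectors e_map I ce. \<forall>m\<in>direction_vectors m_map J cm. e \<bullet> m = 0)"

section \<open>Quasi-Hessian manifolds\<close>

text \<open>Gluing data together with the glued space:
  \<^item> \<open>index\<close>, \<open>model\<close>: the family of local models;
  \<^item> \<open>overlap \<alpha> \<beta>\<close>: the part of \<open>model \<alpha>\<close> that is glued to a part of \<open>model \<beta>\<close>;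
  \<^item> \<open>glue_aff \<alpha> \<beta> x\<close>: the affine Legendre equivalence attached to the connected component of
    \<open>overlap \<alpha> \<beta>\<close> that contains \<open>x\<close>;
  \<^item> \<open>glued\<close>: the manifold, and \<open>incl \<alpha>\<close>: the canonical map of \<open>model \<alpha>\<close> into it.\<close>

record ('i, 'n, 'm) qh_data =
  index :: "'i set"
  model :: "'i \<Rightarrow> 'n pt set"
  overlap :: "'i \<Rightarrow> 'i \<Rightarrow> 'n pt set"
  glue_aff :: "'i \<Rightarrow> 'i \<Rightarrow> 'n pt \<Rightarrow> 'n pt \<Rightarrow> 'n pt"
  glued :: "'m topology"
  incl :: "'i \<Rightarrow> 'n pt \<Rightarrow> 'm"

definition glue :: "('i, 'n::finite, 'm) qh_data \<Rightarrow> 'i \<Rightarrow> 'i \<Rightarrow> 'n pt \<Rightarrow> 'n pt"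
  where "glue Q \<alpha> \<beta> x = glue_aff Q \<alpha> \<beta> x x"

text \<open>The glued space is the quotient of the disjoint union of the local models by the gluing
  relation. By the cocycle condition with \<open>\<gamma> = \<alpha>\<close>, the inverse of \<open>glue Q \<alpha> \<beta>\<close> is \<open>glue Q \<beta> \<alpha>\<close>;
  both maps are affine on connected components, so they are diffeomorphisms.\<close>

definition quasi_hessian_manifold :: "('i, 'n::finite, 'm) qh_data \<Rightarrow> bool"
where
  "quasi_hessian_manifold Q \<longleftrightarrow>
     countable (index Q) \<and>
     (\<forall>\<alpha>\<in>index Q. legendre_submanifold (model Q \<alpha>)) \<and>
     (\<forall>\<alpha>\<in>index Q. \<forall>\<beta>\<in>index Q. openin (top_of_set (model Q \<alpha>)) (overlap Q \<alpha> \<beta>)) \<and>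
     (\<forall>\<alpha>\<in>index Q. overlap Q \<alpha> \<alpha> = model Q \<alpha>) \<and>
     (\<forall>\<alpha>\<in>index Q. \<forall>\<beta>\<in>index Q. \<forall>x\<in>overlap Q \<alpha> \<beta>. affine_legendre (glue_aff Q \<alpha> \<beta> x)) \<and>
     (\<forall>\<alpha>\<in>index Q. \<forall>\<beta>\<in>index Q. \<forall>C\<in>components (overlap Q \<alpha> \<beta>). \<forall>x\<in>C. \<forall>y\<in>C.
        glue_aff Q \<alpha> \<beta> x = glue_aff Q \<alpha> \<beta> y) \<and>
     (\<forall>\<alpha>\<in>index Q. \<forall>\<beta>\<in>index Q. bij_betw (glue Q \<alpha> \<beta>) (overlap Q \<alpha> \<beta>) (overlap Q \<beta> \<alpha>)) \<and>
     (\<forall>\<alpha>\<in>index Q. \<forall>\<beta>\<in>index Q. \<forall>\<gamma>\<in>index Q. \<forall>x\<in>overlap Q \<alpha> \<beta> \<inter> overlap Q \<alpha> \<gamma>.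
        glue Q \<alpha> \<beta> x \<in> overlap Q \<beta> \<gamma> \<and>
        glue_aff Q \<alpha> \<gamma> x = glue_aff Q \<beta> \<gamma> (glue Q \<alpha> \<beta> x) \<circ> glue_aff Q \<alpha> \<beta> x) \<and>
     quotient_map (sum_topology (\<lambda>\<alpha>. top_of_set (model Q \<alpha>)) (index Q)) (glued Q)
       (\<lambda>(\<alpha>, x). incl Q \<alpha> x) \<and>
     (\<forall>\<alpha>\<in>index Q. \<forall>\<beta>\<in>index Q. \<forall>x\<in>model Q \<alpha>. \<forall>y\<in>model Q \<beta>.
        incl Q \<alpha> x = incl Q \<beta> y \<longleftrightarrow> x \<in> overlap Q \<alpha> \<beta> \<and> y = glue Q \<alpha> \<beta> x) \<and>
     Hausdorff_space (glued Q)"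

text \<open>The counterpart for abstract topologies of the library's \<open>simply_connected\<close>.\<close>

definition simply_connected_space :: "'a topology \<Rightarrow> bool"
where
  "simply_connected_space X \<longleftrightarrow>
     (\<forall>g h. pathin X g \<and> g 0 = g 1 \<and> pathin X h \<and> h 0 = h 1 \<longrightarrow>
        homotopic_with (\<lambda>k. k 0 = k 1) (top_of_set {0..1}) X g h)"

text \<open>Continuation of local models by means of the gluing affine Legendre equivalences: on each
  connected component of each local model, \<open>X\<close> is the local model followed by an affine Legendre
  equivalence \<open>G \<alpha> x\<close>, and these equivalences are compatible with the ones in the gluing data. (It
  is not enough to ask for the last conjunct alone, since an affine Legendre equivalence need not
  be determined by its values on a degenerate local model.)\<close>

definition developing_map :: "('i, 'n::finite, 'm) qh_data \<Rightarrow> ('m \<Rightarrow> 'n pt) \<Rightarrow> bool"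
where
  "developing_map Q X \<longleftrightarrow> (\<exists>G.
     (\<forall>\<alpha>\<in>index Q. \<forall>x\<in>model Q \<alpha>. affine_legendre (G \<alpha> x)) \<and>
     (\<forall>\<alpha>\<in>index Q. \<forall>C\<in>components (model Q \<alpha>). \<forall>x\<in>C. \<forall>y\<in>C. G \<alpha> x = G \<alpha> y) \<and>
     (\<forall>\<alpha>\<in>index Q. \<forall>\<beta>\<in>index Q. \<forall>x\<in>overlap Q \<alpha> \<beta>.
        G \<alpha> x = G \<beta> (glue Q \<alpha> \<beta> x) \<circ> glue_aff Q \<alpha> \<beta> x) \<and>
     (\<forall>\<alpha>\<in>index Q. \<forall>x\<in>model Q \<alpha>. X (incl Q \<alpha> x) = G \<alpha> x x))"

text \<open>For a connected and simply connected manifold a developing map exists and is unique up to an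
  affine Legendre equivalence, which leaves \<open>divergence\<close> invariant.\<close>

definition canonical_divergence :: "('i, 'n::finite, 'm) qh_data \<Rightarrow> 'm \<Rightarrow> 'm \<Rightarrow> real"
where
  "canonical_divergence Q p q = (let X = (SOME X. developing_map Q X) in divergence (X p) (X q))"

text \<open>Curves in a quasi-Hessian manifold are described by their representatives in the local
  models: \<open>local_params Q \<alpha> I c\<close> is the set of parameters at which \<open>c\<close> runs in the image of
  \<open>model Q \<alpha>\<close>, and \<open>local_curve Q \<alpha> c\<close> is the representative there. The bundles, bundle maps and
  connections of the local models glue, hence the conditions do not depend on \<open>\<alpha>\<close>.\<close>

definition local_params :: "('i, 'n::finite, 'm) qh_data \<Rightarrow> 'i \<Rightarrow> real set \<Rightarrow> (real \<Rightarrow> 'm) \<Rightarrow> real set"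
  where "local_params Q \<alpha> I c = {t\<in>I. c t \<in> incl Q \<alpha> ` model Q \<alpha>}"

definition local_curve :: "('i, 'n::finite, 'm) qh_data \<Rightarrow> 'i \<Rightarrow> (real \<Rightarrow> 'm) \<Rightarrow> real \<Rightarrow> 'n pt"
  where "local_curve Q \<alpha> c t = inv_into (model Q \<alpha>) (incl Q \<alpha>) (c t)"

definition qh_e_curve :: "('i, 'n::finite, 'm) qh_data \<Rightarrow> real set \<Rightarrow> (real \<Rightarrow> 'm) \<Rightarrow> bool"
where
  "qh_e_curve Q I c \<longleftrightarrow> open_interval I \<and> continuous_map (top_of_set I) (glued Q) c \<and>
     (\<forall>\<alpha>\<in>index Q. straight_on e_map e_frame (local_params Q \<alpha> I c) (local_curve Q \<alpha> c))"

definition qh_m_curve :: "('i, 'n::finite, 'm) qh_data \<Rightarrow> real set \<Rightarrow> (real \<Rightarrow> 'm) \<Rightarrow> bool"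
where
  "qh_m_curve Q I c \<longleftrightarrow> open_interval I \<and> continuous_map (top_of_set I) (glued Q) c \<and>
     (\<forall>\<alpha>\<in>index Q. straight_on m_map m_frame (local_params Q \<alpha> I c) (local_curve Q \<alpha> c))"

text \<open>Strict orthogonality is computed in some local model containing \<open>q\<close>, for the parts of the two
  curves that run through \<open>q\<close> inside that local model.\<close>

definition qh_strictly_orthogonal ::
  "('i, 'n::finite, 'm) qh_data \<Rightarrow> real set \<Rightarrow> (real \<Rightarrow> 'm) \<Rightarrow> real set \<Rightarrow> (real \<Rightarrow> 'm) \<Rightarrow> 'm \<Rightarrow> bool"
where
  "qh_strictly_orthogonal Q I ce J cm q \<longleftrightarrow>
     (\<exists>\<alpha>\<in>index Q. \<exists>t\<in>local_params Q \<alpha> I ce. \<exists>s\<in>local_params Q \<alpha> J cm. ce t = q \<and> cm s = q \<and>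
        (\<forall>e\<in>direction_vectors e_map
               (connected_component_set (local_params Q \<alpha> I ce) t) (local_curve Q \<alpha> ce).
         \<forall>m\<in>direction_vectors m_map
               (connected_component_set (local_params Q \<alpha> J cm) s) (local_curve Q \<alpha> cm).
           e \<bullet> m = 0))"

end

theory Submission
  imports Defs
begin

text \<open>The defect \<open>D(p, r) - D(p, q) - D(q, r)\<close> equals \<open>(x(q) - x(p)) . (p(r) - p(q))\<close>, so it suffices that
  \<open>x\<close> along the e-curve and \<open>p\<close> along the m-curve stay on lines with orthogonal directions. Near a
  parameter, the first nonzero covariant derivative keeps its direction because it is proportional to
  its own derivative, and all other jets are multiples of it; hence the curve of \<open>x\<close> (or \<open>p\<close>) runs
  locally on a line. As it is nowhere locally constant, these lines coincide along the interval.
  Both local properties survive injective affine maps, so on a quasi-Hessian manifold they pass to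
  the curve composed with the developing map, which acts on the directions \<open>e\<close> and \<open>m\<close> by \<open>A\<close> and the
  inverse transpose of \<open>A\<close> and so preserves \<open>e . m\<close>. The developing map exists because the gluing
  equivalences form a locally constant cocycle, which has trivial monodromy on a simply connected
  space.\<close>

text \<open>The Lagrange maps may have critical points, so the velocity of \<open>x\<close> or
  \<open>p\<close> can vanish although the curve is immersed; the line is recovered from a higher
  derivative whose order depends on the parameter. That some derivative is nonzero also excludes
  pieces where the image stands still and the line could bend.

  On a glued manifold orthogonality is given in one local model, for the parameters around
  \<open>q\<close>, while the other two points may lie in other models. Hence the comparison takes
  place in one developed picture, where the direction found near \<open>q\<close> is valid along the
  whole curve. Both curves have the same representative at \<open>q\<close>, so one affine
  equivalence develops them there and supplies the dual pair of matrices.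

  The cocycle takes values in maps of the whole contact space, since a degenerate local model need
  not determine an equivalence. It is trivialized by transport along paths: sections over a square
  come from subdivision, a connected domain leaves only a constant left factor, and simple
  connectedness removes the choice of path.\<close>

section \<open>Curves that locally run on a line\<close>

text \<open>The second condition makes the local line unique, so that overlapping local lines coincide.\<close>

definition locally_straight :: "real set \<Rightarrow> (real \<Rightarrow> 'v::real_normed_vector) \<Rightarrow> bool"
  where "locally_straight T y \<longleftrightarrow> (\<forall>t\<in>T.
    (\<exists>v. v \<noteq> 0 \<and> (\<forall>\<^sub>F s in nhds t. \<exists>u. y s = y t + u *\<^sub>R v)) \<and> \<not> (\<forall>\<^sub>F s in nhds t. y s = y t))"

text \<open>Two distinct points \<open>b\<close> and \<open>b + \<gamma> *\<^sub>R w\<close> of the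
  second line lie on the first, and two points determine a line.\<close>

lemma same_line:
  fixes a b v w :: "'v::real_vector"
  assumes b: "b = a + \<alpha> *\<^sub>R v" and c: "b + \<gamma> *\<^sub>R w = a + \<beta> *\<^sub>R v" and \<gamma>: "\<gamma> \<noteq> 0" and w: "w \<noteq> 0"
  shows "range (\<lambda>u. a + u *\<^sub>R v) = range (\<lambda>u. b + u *\<^sub>R w)"
proof -
  define \<kappa> where "\<kappa> = (\<beta> - \<alpha>) / \<gamma>"
  have "\<gamma> *\<^sub>R w = (\<beta> - \<alpha>) *\<^sub>R v" using b c by (simp add: algebra_simps)
  then have "(1/\<gamma>) *\<^sub>R (\<gamma> *\<^sub>R w) = (1/\<gamma>) *\<^sub>R ((\<beta> - \<alpha>) *\<^sub>R v)" by simp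
  then have wv: "w = \<kappa> *\<^sub>R v" using \<gamma> by (simp add: \<kappa>_def)
  with w have \<kappa>: "\<kappa> \<noteq> 0" by auto
  have "a + u *\<^sub>R v = b + ((u - \<alpha>) / \<kappa>) *\<^sub>R w" for u
  proof -
    have "((u - \<alpha>) / \<kappa>) *\<^sub>R w = (u - \<alpha>) *\<^sub>R v" unfolding wv using \<kappa> by simp
    then show ?thesis by (simp add: b algebra_simps)
  qed
  moreover have "b + u *\<^sub>R w = a + (\<alpha> + u * \<kappa>) *\<^sub>R v" for u
    unfolding wv b by (simp add: algebra_simps)
  ultimately show ?thesis
    by (intro subset_antisym image_subsetI) (metis rangeI)+
qed

text \<open>The local line, taken as a point set, is a locally constant function of the parameter,
  hence constant on the connected set \<open>I\<close>.\<close>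

lemma locally_straight_imp_line:
  assumes I: "connected I" "open I" and y: "locally_straight I y" and t0: "t0 \<in> I"
  shows "\<exists>v. v \<noteq> 0 \<and> (\<forall>t\<in>I. \<exists>u. y t = y t0 + u *\<^sub>R v)"
proof -
  have "\<forall>t\<in>I. \<exists>v. v \<noteq> 0 \<and> (\<forall>\<^sub>F s in nhds t. \<exists>u. y s = y t + u *\<^sub>R v)"
    using y unfolding locally_straight_def by blast
  from bchoice[OF this] obtain V where
    V: "\<And>t. t \<in> I \<Longrightarrow> V t \<noteq> 0" "\<And>t. t \<in> I \<Longrightarrow> \<forall>\<^sub>F s in nhds t. \<exists>u. y s = y t + u *\<^sub>R V t"
    by blast
  \<comment> \<open>Passing to point sets discards the arbitrary scaling of the chosen vectors
    \<open>V t\<close>, which need not be locally constant themselves.\<close>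
  define Z where "Z t = range (\<lambda>u. y t + u *\<^sub>R V t)" for t
  have const: "\<forall>t\<in>I. \<forall>\<^sub>F s in at t within I. Z t = Z s"
  proof
    fix t assume t: "t \<in> I"
    obtain N where N: "open N" "t \<in> N" "\<forall>s\<in>N. \<exists>u. y s = y t + u *\<^sub>R V t"
      using V(2)[OF t] unfolding eventually_nhds by blast
    have eq: "Z t = Z s" if s: "s \<in> N" "s \<in> I" for s
    proof -
      \<comment> \<open>Since \<open>y\<close> is not constant near \<open>s\<close>, some
        \<open>s'\<close> still inside \<open>N\<close> gives a second point on the line at
        \<open>s\<close>; both points lie on the line at \<open>t\<close> by the choice of
        \<open>N\<close>.\<close>
      have "\<exists>s'. y s' \<noteq> y s \<and> s' \<in> N \<and> (\<exists>u. y s' = y s + u *\<^sub>R V s)"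
      proof (rule ccontr)
        assume no: "\<not> ?thesis"
        have "\<forall>\<^sub>F s' in nhds s. s' \<in> N" using N(1) s(1) by (rule eventually_nhds_in_open)
        with V(2)[OF s(2)] have "\<forall>\<^sub>F s' in nhds s. y s' = y s"
          by eventually_elim (use no in blast)
        then show False using y s(2) unfolding locally_straight_def by blast
      qed
      then obtain s' \<gamma> where s': "y s' \<noteq> y s" "s' \<in> N" "y s' = y s + \<gamma> *\<^sub>R V s" by blast
      obtain \<alpha> \<beta> where "y s = y t + \<alpha> *\<^sub>R V t" "y s' = y t + \<beta> *\<^sub>R V t"
        using N(3) s s' by blast
      then show ?thesis
        unfolding Z_def using s' V(1)[OF s(2)] by (intro same_line) auto
    qed
    then show "\<forall>\<^sub>F s in at t within I. Z t = Z s"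
      unfolding eventually_at_topological using N(1,2) by blast
  qed
  have "y t \<in> Z t0" if "t \<in> I" for t
  proof -
    have "Z t0 = Z t" using connected_local_const[OF I(1) t0 that const] .
    moreover have "y t \<in> Z t" unfolding Z_def by (rule range_eqI[of _ _ 0]) simp
    ultimately show ?thesis by simp
  qed
  then show ?thesis
    using V(1)[OF t0] unfolding Z_def by (intro exI[of _ "V t0"]) auto
qed

text \<open>Test against the component \<open>z\<close> of \<open>x\<close> orthogonal to
  \<open>v\<close>: there \<open>x \<bullet> z\<close> equals \<open>z \<bullet> z\<close>. This
  reduces proportionality of vector functions to scalar derivatives.\<close>

lemma inner_zero_imp_multiple:
  fixes x v :: "'v::real_inner"
  assumes "\<And>z. z \<bullet> v = 0 \<Longrightarrow> x \<bullet> z = 0"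
  shows "\<exists>u. x = u *\<^sub>R v"
proof (cases "v = 0")
  case True
  then have "x \<bullet> x = 0" using assms by simp
  then show ?thesis by simp
next
  case False
  define z where "z = x - (x \<bullet> v / (v \<bullet> v)) *\<^sub>R v"
  have "z \<bullet> v = 0" using False by (simp add: z_def inner_diff_left)
  then have "z \<bullet> z = 0" using assms[of z] by (simp add: z_def inner_diff_left inner_diff_right inner_commute)
  then show ?thesis by (auto simp: z_def)
qed

text \<open>\<open>Y k\<close> plays the \<open>k\<close>-th derivative of the curve.
  Proportionality is turned into vanishing scalar derivatives against all vectors orthogonal to the
  expected direction, so no differential equation for the factor has to be solved.\<close>

lemma jet_locally_straight:
  fixes Y :: "nat \<Rightarrow> real \<Rightarrow> 'v::real_inner"
  assumes T: "open T" and deriv: "\<And>k t. t \<in> T \<Longrightarrow> (Y k has_vector_derivative Y (Suc k) t) (at t)"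
    and line: "\<And>t. t \<in> T \<Longrightarrow> line_condition (\<lambda>k. Y (Suc k) t)"
  shows "locally_straight T (Y 0)"
  unfolding locally_straight_def
proof (intro ballI conjI notI)
  fix t assume t: "t \<in> T"
  \<comment> \<open>Any nonvanishing derivative serves. The velocity \<open>Y (Suc 0) t\<close>
    itself may be zero, so \<open>k\<close> depends on \<open>t\<close>.\<close>
  then obtain k where k: "Y (Suc k) t \<noteq> 0" using line unfolding line_condition_def by blast
  show False if "\<forall>\<^sub>F s in nhds t. Y 0 s = Y 0 t"
  proof -
    from that[unfolded eventually_nhds]
    obtain N where N: "open N" "t \<in> N" "\<forall>s\<in>N. Y 0 s = Y 0 t" by (elim exE conjE)
    have zero: "Y (Suc j) s = 0" if "s \<in> N \<inter> T" "\<forall>s\<in>N \<inter> T. Y j s = c" for j s c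
    proof -
      have "(Y j has_vector_derivative 0) (at s)"
      proof (rule has_vector_derivative_transform_within_open)
        show "((\<lambda>_. c) has_vector_derivative 0) (at s)" by simp
        show "open (N \<inter> T)" using N(1) T by blast
        show "s \<in> N \<inter> T" by fact
        show "c = Y j x" if "x \<in> N \<inter> T" for x using \<open>\<forall>s\<in>N \<inter> T. Y j s = c\<close> that by metis
      qed
      then show ?thesis using deriv that(1) vector_derivative_unique_at by blast
    qed
    have "\<forall>s\<in>N \<inter> T. Y (Suc j) s = 0" for j
    proof (induction j)
      case 0
      show ?case using zero[of _ 0 "Y 0 t"] N(3) by blast
    next
      case (Suc j)
      then show ?case using zero[of _ "Suc j" 0] by blast
    qed
    then show False using k t N by blast
  qed
  define v where "v = Y (Suc k) t"
  have "continuous (at t) (Y (Suc k))" using deriv[OF t] has_vector_derivative_continuous by blast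
  then have "\<forall>\<^sub>F s in at t. Y (Suc k) s \<noteq> 0"
    unfolding continuous_at using k tendsto_imp_eventually_ne by blast
  then have "\<forall>\<^sub>F s in nhds t. Y (Suc k) s \<noteq> 0 \<and> s \<in> T"
    using k t eventually_nhds_in_open[OF T t] by (simp add: eventually_nhds_conv_at eventually_conj_iff)
  then obtain e where e: "e > 0" "\<And>s. s \<in> ball t e \<Longrightarrow> Y (Suc k) s \<noteq> 0" "ball t e \<subseteq> T"
    unfolding eventually_nhds_metric by (force simp: dist_commute subset_iff)
  have mult: "\<exists>u. Y (Suc j) s = u *\<^sub>R Y (Suc k) s" if s: "s \<in> ball t e" for s j
  proof (cases "j = k")
    case True
    then show ?thesis by (intro exI[of _ 1]) simp
  next
    case False
    have "s \<in> T" using e(3) s by blast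
    from line[OF this] False
    have "\<exists>a b. (a, b) \<noteq> (0, 0::real) \<and> a *\<^sub>R Y (Suc j) s + b *\<^sub>R Y (Suc k) s = 0"
      unfolding line_condition_def by simp
    then obtain a b where ab: "(a, b) \<noteq> (0, 0::real)" "a *\<^sub>R Y (Suc j) s + b *\<^sub>R Y (Suc k) s = 0"
      by (elim exE conjE)
    then have "a \<noteq> 0" using e(2)[OF s] by auto
    have "a *\<^sub>R Y (Suc j) s = (- b) *\<^sub>R Y (Suc k) s"
      using ab(2) by (simp add: add_eq_0_iff2)
    then have "(1/a) *\<^sub>R (a *\<^sub>R Y (Suc j) s) = (1/a) *\<^sub>R ((- b) *\<^sub>R Y (Suc k) s)" by simp
    then show ?thesis using \<open>a \<noteq> 0\<close> by (auto intro!: exI[of _ "- b / a"])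
  qed
  have conv: "convex (ball t e)" by simp
  have inner: "((\<lambda>s. Y j s \<bullet> z) has_field_derivative Y (Suc j) s \<bullet> z) (at s within ball t e)"
    if "s \<in> ball t e" for j s z
  proof -
    have "(Y j has_vector_derivative Y (Suc j) s) (at s within ball t e)"
      using deriv e(3) that has_vector_derivative_at_within by blast
    then show ?thesis
      unfolding has_vector_derivative_def has_field_derivative_def
      by (auto intro!: derivative_eq_intros simp: fun_eq_iff)
  qed
  have sq: "((\<lambda>s. Y (Suc k) s \<bullet> Y (Suc k) s) has_field_derivative 2 * (Y (Suc (Suc k)) s \<bullet> Y (Suc k) s))
      (at s within ball t e)" if "s \<in> ball t e" for s
  proof -
    have "(Y (Suc k) has_vector_derivative Y (Suc (Suc k)) s) (at s within ball t e)"
      using deriv e(3) that has_vector_derivative_at_within by blast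
    then show ?thesis
      unfolding has_vector_derivative_def has_field_derivative_def
      by (auto intro!: derivative_eq_intros simp: fun_eq_iff inner_commute)
  qed
  have top: "\<exists>u. Y (Suc k) s = u *\<^sub>R v" if s: "s \<in> ball t e" for s
  proof (rule inner_zero_imp_multiple)
    fix z assume z: "z \<bullet> v = 0"
    \<comment> \<open>This is the squared component along \<open>z\<close> of the normalized vector.
      If w' = u w, differentiation multiplies numerator and denominator by the same factor 2u, so
      the quotient has derivative 0 whatever the function u is. Its value at \<open>t\<close> is 0
      because \<open>z \<bullet> v = 0\<close>.\<close>
    let ?q = "\<lambda>s. (Y (Suc k) s \<bullet> z)\<^sup>2 / (Y (Suc k) s \<bullet> Y (Suc k) s)"
    have "(?q has_field_derivative 0) (at r within ball t e)" if r: "r \<in> ball t e" for r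
    proof -
      obtain u where u: "Y (Suc (Suc k)) r = u *\<^sub>R Y (Suc k) r" using mult[OF r] by blast
      show ?thesis
        by (rule DERIV_cong[OF DERIV_divide[OF DERIV_power[OF inner[OF r], of "Suc k" z 2] sq[OF r]]])
          (use e(2)[OF r] in \<open>simp_all add: u power2_eq_square\<close>)
    qed
    then have "\<exists>c. \<forall>r\<in>ball t e. ?q r = c"
      by (rule has_field_derivative_zero_constant[OF conv])
    then obtain c where c: "\<forall>r\<in>ball t e. ?q r = c" by (elim exE)
    have "t \<in> ball t e" using e(1) by simp
    from bspec[OF c this] have "c = 0" using z by (simp add: v_def inner_commute)
    with bspec[OF c s] show "Y (Suc k) s \<bullet> z = 0" using e(2)[OF s] by simp
  qed
  have "\<exists>u. Y 0 s - Y 0 t = u *\<^sub>R v" if s: "s \<in> ball t e" for s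
  proof (rule inner_zero_imp_multiple)
    fix z assume z: "z \<bullet> v = 0"
    have "((\<lambda>s. Y 0 s \<bullet> z) has_field_derivative 0) (at r within ball t e)" if r: "r \<in> ball t e" for r
    proof -
      obtain u u' where "Y (Suc 0) r = u *\<^sub>R Y (Suc k) r" "Y (Suc k) r = u' *\<^sub>R v"
        using mult[OF r] top[OF r] by blast
      then have "Y (Suc 0) r \<bullet> z = 0" using z by (simp add: inner_commute)
      then show ?thesis using inner[OF r, of 0 z] by simp
    qed
    then have "\<exists>c. \<forall>r\<in>ball t e. Y 0 r \<bullet> z = c"
      by (rule has_field_derivative_zero_constant[OF conv])
    then obtain c where c: "\<forall>r\<in>ball t e. Y 0 r \<bullet> z = c" by (elim exE)
    have "t \<in> ball t e" using e(1) by simp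
    from bspec[OF c this] bspec[OF c s] show "(Y 0 s - Y 0 t) \<bullet> z = 0" by (simp add: inner_diff_left)
  qed
  then have "\<forall>s\<in>ball t e. \<exists>u. Y 0 s = Y 0 t + u *\<^sub>R v" by (metis add.commute diff_add_cancel)
  then show "\<exists>v. v \<noteq> 0 \<and> (\<forall>\<^sub>F s in nhds t. \<exists>u. Y 0 s = Y 0 t + u *\<^sub>R v)"
    using k e(1) unfolding v_def eventually_nhds by (meson centre_in_ball open_ball)
qed

section \<open>Parameter shifts, tangent vectors and flat frames\<close>

lemma has_derivative_shift:
  "((\<lambda>x. f (a + x)) has_derivative D) (at x) \<longleftrightarrow> (f has_derivative D) (at (a + x))"
proof
  have sh: "((\<lambda>x. b + x) has_derivative (\<lambda>h. h)) (at y)" for b y :: 'a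
    by (auto intro!: derivative_eq_intros)
  show "((\<lambda>x. f (a + x)) has_derivative D) (at x)" if "(f has_derivative D) (at (a + x))"
    using has_derivative_compose[OF sh that] .
  assume "((\<lambda>x. f (a + x)) has_derivative D) (at x)"
  then have "((\<lambda>x. f (a + x)) has_derivative D) (at (- a + (a + x)))" by simp
  from has_derivative_compose[OF sh this] show "(f has_derivative D) (at (a + x))" by simp
qed

text \<open>\<open>tangent_space\<close> only accepts curves that pass through the point at
  parameter 0, so curves have to be translated in their parameter. The induction works because
  differentiation commutes with translation.\<close>

lemma Ck_on_shift:
  assumes "Ck_on k S f" "\<And>x. x \<in> S' \<Longrightarrow> a + x \<in> S"
  shows "Ck_on k S' (\<lambda>x. f (a + x))"
  using assms(1)
proof (induction k arbitrary: f)
  case 0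
  have "continuous_on S' ((+) a)" by (intro continuous_intros)
  with 0 show ?case
    using assms(2) by (auto intro: continuous_on_compose2)
next
  case (Suc k)
  have "frechet_derivative (\<lambda>x. f (a + x)) (at x) = frechet_derivative f (at (a + x))" for x
    unfolding frechet_derivative_def has_derivative_shift ..
  moreover have "Ck_on k S' (\<lambda>x. frechet_derivative f (at (a + x)) v)" for v
    using Suc.prems by (intro Suc.IH) simp
  ultimately show ?case
    using Suc.prems assms(2) by (auto simp: differentiable_def has_derivative_shift)
qed

lemma smooth_on_derivative:
  fixes g :: "real \<Rightarrow> 'b::real_normed_vector"
  assumes "smooth_on T g"
  shows "smooth_on T (\<lambda>t. frechet_derivative g (at t) 1)"
    and "t \<in> T \<Longrightarrow> (g has_vector_derivative frechet_derivative g (at t) 1) (at t)"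
proof -
  have S: "Ck_on (Suc k) T g" for k using assms unfolding smooth_on_def by blast
  then show "smooth_on T (\<lambda>t. frechet_derivative g (at t) 1)" unfolding smooth_on_def by simp
  assume "t \<in> T"
  with S have "g differentiable (at t)" by simp
  then show "(g has_vector_derivative frechet_derivative g (at t) 1) (at t)"
    by (simp add: frechet_derivative_eq_vector_derivative flip: vector_derivative_works)
qed

lemma velocity_in_tangent_space:
  assumes T: "open T" "t \<in> T" and \<gamma>: "smooth_on T \<gamma>" "\<gamma> ` T \<subseteq> L"
  shows "vector_derivative \<gamma> (at t) \<in> tangent_space L (\<gamma> t)"
proof -
  obtain e where e: "e > 0" "ball t e \<subseteq> T" using T by (meson openE)
  have mem: "t + x \<in> T" if "x \<in> {-e<..<e}" for x
    using e(2) that by (auto simp: subset_iff dist_real_def)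
  have "smooth_on {-e<..<e} (\<lambda>x. \<gamma> (t + x))"
    using \<gamma>(1) Ck_on_shift mem unfolding smooth_on_def by blast
  moreover have "((\<lambda>x. \<gamma> (t + x)) has_vector_derivative vector_derivative \<gamma> (at t)) (at 0)"
    using smooth_on_derivative(2)[OF \<gamma>(1) T(2)] vector_derivative_at
    unfolding has_vector_derivative_def has_derivative_shift by fastforce
  moreover have "(\<lambda>x. \<gamma> (t + x)) ` {-e<..<e} \<subseteq> L" using mem \<gamma>(2) by blast
  ultimately show ?thesis
    unfolding tangent_space_def using e(1) by (auto intro!: exI[of _ "\<lambda>x. \<gamma> (t + x)"] exI[of _ e])
qed

text \<open>The frame vectors project to the standard basis under \<open>fst\<close>, so the
  coordinates of a fibre vector are its first component. The vector \<open>l\<close> stands for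
  \<open>pc q\<close> in the bundle E and for \<open>xc q\<close> in E'.\<close>

lemma frame_coords_axis:
  fixes l :: "real^'n::finite"
  shows "(\<Sum>i\<in>UNIV. a $ i *\<^sub>R (axis i 1 :: real^'n, l $ i)) = (a, l \<bullet> a)"
    and "frame_coords (\<lambda>i. (axis i 1, l $ i)) (a, l \<bullet> a) = a"
proof -
  have sum: "(\<Sum>i\<in>UNIV. a $ i *\<^sub>R (axis i 1 :: real^'n, l $ i)) = (a, l \<bullet> a)" for a
    by (rule prod_eqI)
      (simp_all add: fst_sum snd_sum inner_vec_def mult.commute vec_eq_iff axis_def if_distrib cong: if_cong)
  then show "(\<Sum>i\<in>UNIV. a $ i *\<^sub>R (axis i 1 :: real^'n, l $ i)) = (a, l \<bullet> a)" .
  show "frame_coords (\<lambda>i. (axis i 1, l $ i)) (a, l \<bullet> a) = a"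
    unfolding frame_coords_def by (rule the_equality) (auto simp: sum simp del: scaleR_Pair)
qed

text \<open>Common form of the e- and the m-case: \<open>P\<close> is the coordinate of the Lagrange
  map and \<open>l\<close> the dual coordinate. In the flat frame the \<open>k\<close>-th covariant
  derivative of the velocity has as coordinates the ordinary derivative of order
  \<open>k + 1\<close> of \<open>P\<close> along the curve.\<close>

lemma straight_on_locally_straight:
  fixes P :: "'n::finite pt \<Rightarrow> real^'n" and l :: "'n pt \<Rightarrow> real^'n"
  assumes P: "bounded_linear P"
    and s: "\<And>q. s q = (\<lambda>i. (axis i 1, l q $ i))"
    and f: "\<And>q v. contact_form q v = 0 \<Longrightarrow> frechet_derivative f (at q) v = (P v, l q \<bullet> P v)"
    and L: "legendre_submanifold L" and T: "open T" and im: "\<gamma> ` T \<subseteq> L"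
    and st: "straight_on f s T \<gamma>"
  shows "locally_straight T (\<lambda>t. P (\<gamma> t))"
proof -
  have smooth: "smooth_on T \<gamma>" using st unfolding straight_on_def by blast
  define D where "D k = ((\<lambda>g t. frechet_derivative g (at t) 1) ^^ k) \<gamma>" for k
  have D: "smooth_on T (D k)" for k
    by (induction k) (simp_all add: D_def smooth smooth_on_derivative(1))
  have D': "(D k has_vector_derivative D (Suc k) t) (at t)" if "t \<in> T" for k t
    using smooth_on_derivative(2)[OF D that, of k] by (simp add: D_def)
  define Y where "Y k t = P (D k t)" for k t
  have Y: "(Y k has_vector_derivative Y (Suc k) t) (at t)" if "t \<in> T" for k t
    unfolding Y_def using bounded_linear.has_vector_derivative[OF P D'[OF that]] .
  have jet: "\<forall>t\<in>T. nabla_jet f s \<gamma> t k = (Y (Suc k) t, l (\<gamma> t) \<bullet> Y (Suc k) t)" for k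
  proof (induction k)
    case 0
    show ?case
    proof
      fix t assume t: "t \<in> T"
      have vd: "vector_derivative \<gamma> (at t) = D 1 t"
        using D'[OF t, of 0] vector_derivative_at by (auto simp: D_def)
      \<comment> \<open>Here the Legendre condition enters: it places the velocity section in the
        fibre, which is the graph of the pairing with \<open>l (\<gamma> t)\<close>.\<close>
      have "contact_form (\<gamma> t) (vector_derivative \<gamma> (at t)) = 0"
        using L velocity_in_tangent_space[OF T t smooth im] im t unfolding legendre_submanifold_def by blast
      then show "nabla_jet f s \<gamma> t 0 = (Y (Suc 0) t, l (\<gamma> t) \<bullet> Y (Suc 0) t)"
        by (simp add: nabla_jet_def velocity_section_def f Y_def vd)
    qed
  next
    case (Suc k)
    show ?case
    proof
      fix t assume t: "t \<in> T"
      \<comment> \<open>The derivative at \<open>t\<close> reads only nearby parameters and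
        \<open>T\<close> is open, so the induction hypothesis identifies the frame coordinates near
        \<open>t\<close>.\<close>
      have "((\<lambda>\<tau>. frame_coords (s (\<gamma> \<tau>)) (nabla_jet f s \<gamma> \<tau> k)) has_vector_derivative Y (Suc (Suc k)) t) (at t)"
      proof (rule has_vector_derivative_transform_within_open[OF Y[OF t] T t])
        fix \<tau> assume "\<tau> \<in> T"
        then have "nabla_jet f s \<gamma> \<tau> k = (Y (Suc k) \<tau>, l (\<gamma> \<tau>) \<bullet> Y (Suc k) \<tau>)" using Suc by blast
        then show "Y (Suc k) \<tau> = frame_coords (s (\<gamma> \<tau>)) (nabla_jet f s \<gamma> \<tau> k)"
          unfolding s by (simp add: frame_coords_axis(2))
      qed
      then have "vector_derivative (\<lambda>\<tau>. frame_coords (s (\<gamma> \<tau>)) (nabla_jet f s \<gamma> \<tau> k)) (at t) = Y (Suc (Suc k)) t"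
        by (rule vector_derivative_at)
      then show "nabla_jet f s \<gamma> t (Suc k) = (Y (Suc (Suc k)) t, l (\<gamma> t) \<bullet> Y (Suc (Suc k)) t)"
        unfolding nabla_jet_def funpow.simps o_apply cov_deriv_def[of s \<gamma> "(cov_deriv s \<gamma> ^^ k) (velocity_section f \<gamma>)"]
        by (simp only: s frame_coords_axis(1))
    qed
  qed
  have line: "line_condition (\<lambda>k. Y (Suc k) t)" if t: "t \<in> T" for t
  proof -
    have "nabla_jet f s \<gamma> t = (\<lambda>k. (Y (Suc k) t, l (\<gamma> t) \<bullet> Y (Suc k) t))"
      using jet t by blast
    then have lc: "line_condition (\<lambda>k. (Y (Suc k) t, l (\<gamma> t) \<bullet> Y (Suc k) t))"
      using st t unfolding straight_on_def by metis
    \<comment> \<open>The second component is a linear function of the first, the same for all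
      \<open>k\<close>, so vanishing and dependence can be read off the first.\<close>
    then have "\<exists>k. Y (Suc k) t \<noteq> 0" unfolding line_condition_def by (auto simp: zero_prod_def)
    moreover have "\<exists>a b. (a, b) \<noteq> (0, 0::real) \<and> a *\<^sub>R Y (Suc j) t + b *\<^sub>R Y (Suc k) t = 0" if "j \<noteq> k" for j k
      using lc that unfolding line_condition_def by (simp add: zero_prod_def) blast
    ultimately show ?thesis unfolding line_condition_def by blast
  qed
  have "Y 0 = (\<lambda>t. P (\<gamma> t))" by (simp add: fun_eq_iff Y_def D_def)
  with jet_locally_straight[OF T Y line] show ?thesis by metis
qed

lemma bounded_linear_xc: "bounded_linear xc" and bounded_linear_pc: "bounded_linear pc"
  and bounded_linear_zc: "bounded_linear zc"
  unfolding xc_def[abs_def] pc_def[abs_def] zc_def[abs_def]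
  by (intro bounded_linear_fst bounded_linear_snd bounded_linear_compose[of fst snd] bounded_linear_compose[of snd snd])+

lemma e_straight:
  assumes "legendre_submanifold L" "open T" "\<gamma> ` T \<subseteq> L" "straight_on e_map e_frame T \<gamma>"
  shows "locally_straight T (\<lambda>t. xc (\<gamma> t))"
proof (rule straight_on_locally_straight[OF bounded_linear_xc _ _ assms])
  show "e_frame q = (\<lambda>i. (axis i 1, pc q $ i))" for q :: "'a pt" by (simp add: e_frame_def fun_eq_iff)
  fix q v :: "'a pt" assume c: "contact_form q v = 0"
  have "(e_map has_derivative (\<lambda>v. (xc v, zc v))) (at q)"
    unfolding e_map_def[abs_def]
    by (intro has_derivative_Pair bounded_linear_imp_has_derivative bounded_linear_xc bounded_linear_zc)
  then show "frechet_derivative e_map (at q) v = (xc v, pc q \<bullet> xc v)"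
    using c by (simp add: frechet_derivative_at[symmetric] contact_form_def)
qed

text \<open>On contact vectors dz = p . dx, so dz' = d(p . x) - dz = x . dp: Legendre duality
  exchanges the roles of the two coordinates.\<close>

lemma m_straight:
  assumes "legendre_submanifold L" "open T" "\<gamma> ` T \<subseteq> L" "straight_on m_map m_frame T \<gamma>"
  shows "locally_straight T (\<lambda>t. pc (\<gamma> t))"
proof (rule straight_on_locally_straight[OF bounded_linear_pc _ _ assms])
  show "m_frame q = (\<lambda>i. (axis i 1, xc q $ i))" for q :: "'a pt" by (simp add: m_frame_def fun_eq_iff)
  fix q v :: "'a pt" assume c: "contact_form q v = 0"
  have "(m_map has_derivative (\<lambda>v. (pc v, (pc q \<bullet> xc v + pc v \<bullet> xc q) - zc v))) (at q)"
    unfolding m_map_def[abs_def] zc'_def[abs_def]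
    by (intro has_derivative_Pair has_derivative_diff has_derivative_inner bounded_linear_imp_has_derivative
        bounded_linear_xc bounded_linear_zc bounded_linear_pc)
  then show "frechet_derivative m_map (at q) v = (pc v, xc q \<bullet> pc v)"
    using c by (simp add: frechet_derivative_at[symmetric] contact_form_def inner_commute)
qed

section \<open>The group of affine Legendre equivalences\<close>

lemma matrix_inv_mult:
  assumes "invertible (A :: real^'n^'m)"
  shows "A ** matrix_inv A = mat 1" "matrix_inv A ** A = mat 1"
  using someI_ex[OF assms[unfolded invertible_def]] unfolding matrix_inv_def by blast+

text \<open>A normal form for computing in the group: the inverse transpose becomes a second matrix
  \<open>B\<close> tied to \<open>A\<close> by one equation, and the translation of \<open>p\<close>
  is moved inside \<open>B\<close>, so that the same \<open>c\<close> occurs in both places.\<close>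

lemma affine_legendre_iff:
  "affine_legendre (F :: 'n::finite pt \<Rightarrow> 'n pt) \<longleftrightarrow>
    (\<exists>(A :: real^'n^'n) B b c d. transpose A ** B = mat 1 \<and>
      F = (\<lambda>q. (A *v xc q + b, B *v (pc q + c), zc q + c \<bullet> xc q + d)))"
proof
  assume "affine_legendre F"
  then obtain A :: "real^'n^'n" and b c d where A: "invertible A"
    "F = (\<lambda>q. (A *v xc q + b, matrix_inv (transpose A) *v pc q + matrix_inv (transpose A) *v c,
           zc q + c \<bullet> xc q + d))"
    unfolding affine_legendre_def Let_def by blast
  then have "transpose A ** matrix_inv (transpose A) = mat 1"
    using matrix_inv_mult(1) transpose_invertible by blast
  with A(2) show "\<exists>(A :: real^'n^'n) B b c d. transpose A ** B = mat 1 \<and>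
      F = (\<lambda>q. (A *v xc q + b, B *v (pc q + c), zc q + c \<bullet> xc q + d))"
    by (intro exI[of _ A] exI[of _ "matrix_inv (transpose A)"] exI[of _ b] exI[of _ c] exI[of _ d])
      (simp add: matrix_vector_right_distrib)
next
  assume "\<exists>(A :: real^'n^'n) B b c d. transpose A ** B = mat 1 \<and>
      F = (\<lambda>q. (A *v xc q + b, B *v (pc q + c), zc q + c \<bullet> xc q + d))"
  then obtain A B :: "real^'n^'n" and b c d where A: "transpose A ** B = mat 1"
    "F = (\<lambda>q. (A *v xc q + b, B *v (pc q + c), zc q + c \<bullet> xc q + d))" by blast
  have inv: "invertible (transpose A)" using A(1) matrix_left_right_inverse unfolding invertible_def by blast
  then have "invertible A" using transpose_invertible[of "transpose A"] by simp
  moreover have "matrix_inv (transpose A) = B"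
    by (metis A(1) inv matrix_inv_mult(2) matrix_mul_assoc matrix_mul_lid matrix_mul_rid)
  ultimately show "affine_legendre F"
    unfolding affine_legendre_def Let_def
    by (intro exI[of _ A] exI[of _ b] exI[of _ c] exI[of _ d]) (simp add: A(2) matrix_vector_right_distrib)
qed

lemma transpose_dot: "(transpose A *v x) \<bullet> (y :: real^'n) = x \<bullet> (A *v y)" for A :: "real^'n^'n"
  by (metis dot_lmul_matrix transpose_matrix_vector)

lemma affine_legendre_id: "affine_legendre id"
  unfolding affine_legendre_iff
  by (rule exI[of _ "mat 1"], rule exI[of _ "mat 1"], rule exI[of _ 0], rule exI[of _ 0], rule exI[of _ 0])
    (auto simp: fun_eq_iff xc_def pc_def zc_def)

lemma affine_legendre_comp:
  fixes F G :: "'n::finite pt \<Rightarrow> 'n pt"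
  assumes "affine_legendre F" "affine_legendre G"
  shows "affine_legendre (F \<circ> G)"
proof -
  obtain A B :: "real^'n^'n" and b c d where F: "transpose A ** B = mat 1"
    "F = (\<lambda>q. (A *v xc q + b, B *v (pc q + c), zc q + c \<bullet> xc q + d))"
    using assms(1) unfolding affine_legendre_iff by blast
  obtain A' B' :: "real^'n^'n" and b' c' d' where G: "transpose A' ** B' = mat 1"
    "G = (\<lambda>q. (A' *v xc q + b', B' *v (pc q + c'), zc q + c' \<bullet> xc q + d'))"
    using assms(2) unfolding affine_legendre_iff by blast
  have inv: "transpose (A ** A') ** (B ** B') = mat 1"
    using F(1) G(1) by (simp add: matrix_transpose_mul) (metis matrix_mul_assoc matrix_mul_lid)
  \<comment> \<open>\<open>B'\<close> inverts \<open>transpose A'\<close>. Hence the inner shift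
    \<open>c\<close> of \<open>F\<close> can be carried past \<open>B'\<close>, becoming
    \<open>transpose A' *v c\<close>; pairing \<open>c\<close> with \<open>A' *v x\<close> in the
    third component produces the same vector.\<close>
  have B': "B' *v (transpose A' *v v) = v" for v
    using G(1) by (simp add: matrix_vector_mul_assoc matrix_left_right_inverse del: transpose_matrix_vector)
  have "F \<circ> G = (\<lambda>q. ((A ** A') *v xc q + (A *v b' + b),
     (B ** B') *v (pc q + (c' + transpose A' *v c)),
     zc q + (c' + transpose A' *v c) \<bullet> xc q + (d' + d + c \<bullet> b')))"
    unfolding F(2) G(2)
    by (auto simp: fun_eq_iff xc_def pc_def zc_def matrix_vector_mul_assoc[symmetric] B'
        matrix_vector_right_distrib inner_add_left inner_add_right transpose_dot algebra_simps
        simp del: transpose_matrix_vector)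
  with inv show ?thesis unfolding affine_legendre_iff by blast
qed

lemma affine_legendre_inverse:
  fixes F :: "'n::finite pt \<Rightarrow> 'n pt"
  assumes "affine_legendre F"
  shows "bij F" "affine_legendre (inv F)"
proof -
  obtain A B :: "real^'n^'n" and b c d where F: "transpose A ** B = mat 1"
    "F = (\<lambda>q. (A *v xc q + b, B *v (pc q + c), zc q + c \<bullet> xc q + d))"
    using assms unfolding affine_legendre_iff by blast
  have BA: "B ** transpose A = mat 1" using F(1) matrix_left_right_inverse by blast
  have "transpose (transpose A ** B) = mat 1" "transpose (B ** transpose A) = mat 1"
    unfolding F(1) BA by simp_all
  then have AB: "transpose B ** A = mat 1" "A ** transpose B = mat 1"
    by (simp_all add: matrix_transpose_mul transpose_transpose)
  note vec = AB[THEN arg_cong[where f = "\<lambda>M. M *v v" for v], unfolded matrix_vector_mul_assoc[symmetric] matrix_vector_mul_lid]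
    F(1)[THEN arg_cong[where f = "\<lambda>M. M *v v" for v], unfolded matrix_vector_mul_assoc[symmetric] matrix_vector_mul_lid]
    BA[THEN arg_cong[where f = "\<lambda>M. M *v v" for v], unfolded matrix_vector_mul_assoc[symmetric] matrix_vector_mul_lid]
  \<comment> \<open>Obtained by solving \<open>F\<close> for its argument:
    \<open>transpose B\<close> and \<open>transpose A\<close> invert \<open>A\<close> and
    \<open>B\<close>, and substituting x = \<open>transpose B *v (x' - b)\<close> into z = z' - c .
    x - d gives the shift \<open>- (B *v c)\<close> and the constant
    \<open>(B *v c) \<bullet> b - d\<close>.\<close>
  define G :: "'n pt \<Rightarrow> 'n pt" where "G = (\<lambda>q. (transpose B *v xc q + (- (transpose B *v b)),
     transpose A *v (pc q + (- (B *v c))), zc q + (- (B *v c)) \<bullet> xc q + ((B *v c) \<bullet> b - d)))"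
  have dot: "(B *v u) \<bullet> v = u \<bullet> (transpose B *v v)" for u v
    using transpose_dot[of "transpose B"] by (simp add: transpose_transpose del: transpose_matrix_vector)
  have GF: "G \<circ> F = id"
    unfolding F(2) G_def
    by (auto simp: fun_eq_iff xc_def pc_def zc_def vec dot
        matrix_vector_right_distrib inner_add_left inner_add_right inner_diff_right linear_neg linear_diff algebra_simps
        simp del: transpose_matrix_vector)
  have FG: "F \<circ> G = id"
    unfolding F(2) G_def
    by (auto simp: fun_eq_iff xc_def pc_def zc_def vec dot
        matrix_vector_right_distrib inner_add_left inner_add_right inner_diff_right linear_neg linear_diff algebra_simps
        simp del: transpose_matrix_vector)
  from GF FG show "bij F" by (rule o_bij)
  have "inv F = G" using FG GF by (rule inv_unique_comp)
  moreover have "affine_legendre G"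
    unfolding affine_legendre_iff G_def by (rule exI[of _ "transpose B"], rule exI[of _ "transpose A"], intro exI conjI, simp add: BA, rule refl)
  ultimately show "affine_legendre (inv F)" by simp
qed

section \<open>Monodromy of locally constant cocycles\<close>

text \<open>Transition data of a principal bundle with discrete structure group \<open>S\<close>:
  \<open>k i j m\<close> leads from chart \<open>i\<close> to chart \<open>j\<close> at the point
  \<open>m\<close>. The setting is abstract because the monodromy argument uses only the group and
  the topology.\<close>

locale flat_cocycle =
  fixes X :: "'m topology" and I :: "'i set" and U :: "'i \<Rightarrow> 'm set"
    and S :: "('p \<Rightarrow> 'p) set" and k :: "'i \<Rightarrow> 'i \<Rightarrow> 'm \<Rightarrow> 'p \<Rightarrow> 'p"
  assumes openin_U: "i \<in> I \<Longrightarrow> openin X (U i)"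
    and cover: "m \<in> topspace X \<Longrightarrow> \<exists>i\<in>I. m \<in> U i"
    and S_bij: "f \<in> S \<Longrightarrow> bij f"
    and S_id: "id \<in> S"
    and S_comp: "f \<in> S \<Longrightarrow> g \<in> S \<Longrightarrow> f \<circ> g \<in> S"
    and S_inv: "f \<in> S \<Longrightarrow> inv f \<in> S"
    and k_in: "i \<in> I \<Longrightarrow> j \<in> I \<Longrightarrow> m \<in> U i \<Longrightarrow> m \<in> U j \<Longrightarrow> k i j m \<in> S"
    and k_cocycle: "i \<in> I \<Longrightarrow> j \<in> I \<Longrightarrow> l \<in> I \<Longrightarrow> m \<in> U i \<Longrightarrow> m \<in> U j \<Longrightarrow> m \<in> U l \<Longrightarrow>
      k i l m = k j l m \<circ> k i j m"
    and k_local: "i \<in> I \<Longrightarrow> j \<in> I \<Longrightarrow> m \<in> U i \<Longrightarrow> m \<in> U j \<Longrightarrow>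
      \<exists>V. openin X V \<and> m \<in> V \<and> (\<forall>m'\<in>V. k i j m' = k i j m)"
begin

text \<open>Parallel sections of the bundle pulled back along \<open>f\<close>, where
  \<open>h i y\<close> is the expression in chart \<open>i\<close>. An arbitrary \<open>f\<close>
  lets one notion serve for paths and for homotopy squares.\<close>

definition flat_on :: "'b::metric_space set \<Rightarrow> ('b \<Rightarrow> 'm) \<Rightarrow> ('i \<Rightarrow> 'b \<Rightarrow> 'p \<Rightarrow> 'p) \<Rightarrow> bool"
  where "flat_on A f h \<longleftrightarrow> (\<forall>y\<in>A. \<forall>i\<in>I. f y \<in> U i \<longrightarrow>
     h i y \<in> S \<and> (\<forall>j\<in>I. f y \<in> U j \<longrightarrow> h i y = h j y \<circ> k i j (f y)) \<and>
     (\<forall>\<^sub>F y' in at y within A. h i y' = h i y))"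

lemma flat_onD:
  assumes "flat_on A f h" "y \<in> A" "i \<in> I" "f y \<in> U i"
  shows "h i y \<in> S" "j \<in> I \<Longrightarrow> f y \<in> U j \<Longrightarrow> h i y = h j y \<circ> k i j (f y)"
    "\<forall>\<^sub>F y' in at y within A. h i y' = h i y"
  using assms unfolding flat_on_def by blast+

lemma eventually_U:
  assumes "continuous_map (top_of_set A) X f" "y \<in> A" "openin X V" "f y \<in> V"
  shows "\<forall>\<^sub>F y' in at y within A. f y' \<in> V"
proof -
  have "openin (top_of_set A) {x \<in> topspace (top_of_set A). f x \<in> V}"
    using assms by (intro openin_continuous_map_preimage)
  then obtain W where W: "open W" "{x \<in> A. f x \<in> V} = A \<inter> W"
    by (auto simp: openin_open)
  with assms have "y \<in> W" by blast
  with W show ?thesis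
    unfolding eventually_at_topological by blast
qed

text \<open>Inside one chart the transitions into that chart are themselves a flat section, by the
  cocycle condition and local constancy.\<close>

lemma flat_on_single:
  assumes f: "continuous_map (top_of_set A) X f" and i: "i \<in> I" and sub: "f ` A \<subseteq> U i"
  shows "flat_on A f (\<lambda>j y. k j i (f y))"
  unfolding flat_on_def
proof (intro ballI impI conjI)
  fix y j assume y: "y \<in> A" "j \<in> I" "f y \<in> U j"
  have yi: "f y \<in> U i" using y sub by blast
  show "k j i (f y) \<in> S" using k_in y yi i by blast
  show "k j i (f y) = k l i (f y) \<circ> k j l (f y)" if "l \<in> I" "f y \<in> U l" for l
    using k_cocycle y yi i that by blast
  obtain V where V: "openin X V" "f y \<in> V" "\<forall>m'\<in>V. k j i m' = k j i (f y)"
    using k_local[of j i "f y"] y yi i by blast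
  show "\<forall>\<^sub>F y' in at y within A. k j i (f y') = k j i (f y)"
    using eventually_U[OF f y(1) V(1,2)] by (rule eventually_mono) (use V in blast)
qed

lemma flat_on_compose:
  assumes h: "flat_on A f h" and \<phi>: "continuous_on B \<phi>" "\<phi> ` B \<subseteq> A"
  shows "flat_on B (\<lambda>y. f (\<phi> y)) (\<lambda>i y. h i (\<phi> y))"
  unfolding flat_on_def
proof (intro ballI impI conjI)
  fix y i assume y: "y \<in> B" "i \<in> I" "f (\<phi> y) \<in> U i"
  have yA: "\<phi> y \<in> A" using y \<phi> by blast
  show "h i (\<phi> y) \<in> S" using flat_onD[OF h yA] y by blast
  show "h i (\<phi> y) = h j (\<phi> y) \<circ> k i j (f (\<phi> y))" if "j \<in> I" "f (\<phi> y) \<in> U j" for j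
    using flat_onD[OF h yA] y that by blast
  have "\<forall>\<^sub>F y' in at (\<phi> y) within A. h i y' = h i (\<phi> y)"
    using flat_onD[OF h yA] y by blast
  then obtain W where W: "open W" "\<phi> y \<in> W" "\<forall>x\<in>W. x \<noteq> \<phi> y \<longrightarrow> x \<in> A \<longrightarrow> h i x = h i (\<phi> y)"
    unfolding eventually_at_topological by blast
  have "(\<phi> \<longlongrightarrow> \<phi> y) (at y within B)"
    using \<phi> y by (auto simp: continuous_on_def)
  then have "\<forall>\<^sub>F y' in at y within B. \<phi> y' \<in> W"
    using W by (blast intro: topological_tendstoD)
  moreover have "\<forall>\<^sub>F y' in at y within B. y' \<in> B"
    by (simp add: eventually_at_filter)
  ultimately show "\<forall>\<^sub>F y' in at y within B. h i (\<phi> y') = h i (\<phi> y)"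
    by eventually_elim (use W \<phi> in \<open>metis image_subset_iff\<close>)
qed

lemma flat_on_cong:
  assumes h: "flat_on A f h" and "\<And>y. y \<in> A \<Longrightarrow> f' y = f y" "\<And>i y. y \<in> A \<Longrightarrow> h' i y = h i y"
  shows "flat_on A f' h'"
  unfolding flat_on_def
proof (intro ballI impI)
  fix y i assume y: "y \<in> A" "i \<in> I" "f' y \<in> U i"
  note h_y = flat_onD[OF h y(1,2)]
  have f': "f y \<in> U i" using y assms by simp
  have "\<forall>\<^sub>F y' in at y within A. y' \<in> A"
    by (simp add: eventually_at_filter)
  with h_y(3)[OF f'] have "\<forall>\<^sub>F y' in at y within A. h' i y' = h' i y"
    by eventually_elim (use assms y in simp)
  then show "h' i y \<in> S \<and> (\<forall>j\<in>I. f' y \<in> U j \<longrightarrow> h' i y = h' j y \<circ> k i j (f' y)) \<and>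
      (\<forall>\<^sub>F y' in at y within A. h' i y' = h' i y)"
    unfolding assms(2)[OF y(1)] assms(3)[OF y(1)] using h_y(1,2)[OF f'] by blast
qed

text \<open>Transitions act on the right, so a constant factor on the left does not disturb them.
  Such factors are the freedom used for gluing and normalizing sections.\<close>

lemma flat_on_left_mult:
  assumes h: "flat_on A f h" and c: "c \<in> S"
  shows "flat_on A f (\<lambda>i y. c \<circ> h i y)"
  unfolding flat_on_def
proof (intro ballI impI conjI)
  fix y i assume y: "y \<in> A" "i \<in> I" "f y \<in> U i"
  note h_y = flat_onD[OF h y]
  show "c \<circ> h i y \<in> S" using h_y(1) c S_comp by blast
  show "c \<circ> h i y = c \<circ> h j y \<circ> k i j (f y)" if "j \<in> I" "f y \<in> U j" for j
    using h_y(2) that by (simp add: comp_assoc)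
  show "\<forall>\<^sub>F y' in at y within A. c \<circ> h i y' = c \<circ> h i y"
    using h_y(3) by (rule eventually_mono) simp
qed

text \<open>The filter at \<open>y\<close> within the union is the supremum of those within
  \<open>A\<close> and \<open>B\<close>; closedness makes the filter trivial for a piece that misses
  \<open>y\<close>.\<close>

lemma flat_on_union:
  assumes f: "continuous_map (top_of_set (A \<union> B)) X f" and A: "closed A" and B: "closed B"
    and h1: "flat_on A f h1" and h2: "flat_on B f h2"
    and eq: "\<And>y i. y \<in> A \<Longrightarrow> y \<in> B \<Longrightarrow> i \<in> I \<Longrightarrow> f y \<in> U i \<Longrightarrow> h1 i y = h2 i y"
  shows "flat_on (A \<union> B) f (\<lambda>i y. if y \<in> A then h1 i y else h2 i y)"
  unfolding flat_on_def
proof (intro ballI impI)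
  fix y i assume y: "y \<in> A \<union> B" "i \<in> I" "f y \<in> U i"
  let ?h = "\<lambda>i y. if y \<in> A then h1 i y else h2 i y"
  have onB: "?h j y = h2 j y" if "y \<in> B" "j \<in> I" "f y \<in> U j" for j
    using eq that by simp
  have evA: "\<forall>\<^sub>F y' in at y within A. ?h i y' = ?h i y"
  proof (cases "y \<in> A")
    case True
    have "\<forall>\<^sub>F y' in at y within A. y' \<in> A" by (simp add: eventually_at_filter)
    with flat_onD(3)[OF h1 True y(2,3)] show ?thesis
      by eventually_elim (use True in simp)
  next
    case False
    then show ?thesis using A by (simp add: not_in_closure_trivial_limitI)
  qed
  have evB: "\<forall>\<^sub>F y' in at y within B. ?h i y' = ?h i y"
  proof (cases "y \<in> B")
    case True
    \<comment> \<open>Agreement of \<open>h1\<close> and \<open>h2\<close> is only assumed in charts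
      that contain the image point, so nearby images must first be kept inside
      \<open>U i\<close>.\<close>
    have "\<forall>\<^sub>F y' in at y within A \<union> B. f y' \<in> U i"
      using eventually_U[OF f y(1) openin_U] y by blast
    then have "\<forall>\<^sub>F y' in at y within B. f y' \<in> U i"
      by (simp add: at_within_union eventually_sup)
    moreover have "\<forall>\<^sub>F y' in at y within B. y' \<in> B" by (simp add: eventually_at_filter)
    ultimately show ?thesis
      using flat_onD(3)[OF h2 True y(2,3)]
      by eventually_elim (use onB[OF True y(2,3)] eq y in auto)
  next
    case False
    then show ?thesis using B by (simp add: not_in_closure_trivial_limitI)
  qed
  have "?h i y \<in> S \<and> (\<forall>j\<in>I. f y \<in> U j \<longrightarrow> ?h i y = ?h j y \<circ> k i j (f y))"
  proof (cases "y \<in> A")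
    case True
    then show ?thesis using flat_onD[OF h1 True y(2,3)] by auto
  next
    case False
    with y have "y \<in> B" by simp
    then show ?thesis using False flat_onD[OF h2 _ y(2,3)] by auto
  qed
  with evA evB show "?h i y \<in> S \<and> (\<forall>j\<in>I. f y \<in> U j \<longrightarrow> ?h i y = ?h j y \<circ> k i j (f y)) \<and>
      (\<forall>\<^sub>F y' in at y within A \<union> B. ?h i y' = ?h i y)"
    by (simp only: at_within_union eventually_sup) blast
qed

text \<open>The quotient of two flat sections does not depend on the chart and is locally constant.\<close>

lemma flat_on_unique:
  assumes f: "continuous_map (top_of_set A) X f" and A: "connected A"
    and h1: "flat_on A f h1" and h2: "flat_on A f h2"
  shows "\<exists>c\<in>S. \<forall>y\<in>A. \<forall>i\<in>I. f y \<in> U i \<longrightarrow> h1 i y = c \<circ> h2 i y"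
proof (cases "A = {}")
  case True
  then show ?thesis using S_id by blast
next
  case False
  have fX: "f y \<in> topspace X" if "y \<in> A" for y
    using f that by (auto simp: continuous_map_def)
  define ch where "ch y = (SOME i. i \<in> I \<and> f y \<in> U i)" for y
  have ch: "ch y \<in> I" "f y \<in> U (ch y)" if "y \<in> A" for y
    using someI_ex[of "\<lambda>i. i \<in> I \<and> f y \<in> U i"] cover[OF fX[OF that]] unfolding ch_def by blast+
  define c where "c y = h1 (ch y) y \<circ> inv (h2 (ch y) y)" for y
  have c: "c y = h1 i y \<circ> inv (h2 i y)" if "y \<in> A" "i \<in> I" "f y \<in> U i" for y i
  proof -
    let ?k = "k (ch y) i (f y)"
    have b: "bij (h2 i y)" "bij ?k"
      using flat_onD(1)[OF h2 that] k_in[of "ch y" i "f y"] ch[OF that(1)] that S_bij by blast+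
    have "h1 (ch y) y = h1 i y \<circ> ?k" "h2 (ch y) y = h2 i y \<circ> ?k"
      using flat_onD(2)[OF h1 that(1) ch[OF that(1)] that(2,3)]
        flat_onD(2)[OF h2 that(1) ch[OF that(1)] that(2,3)] by auto
    then have "c y = h1 i y \<circ> (?k \<circ> inv ?k) \<circ> inv (h2 i y)"
      unfolding c_def using b by (simp add: o_inv_distrib comp_assoc)
    then show ?thesis using b by (simp add: bij_is_surj surj_iff[THEN iffD1])
  qed
  have "\<forall>\<^sub>F y' in at y within A. c y = c y'" if y: "y \<in> A" for y
  proof -
    note i = ch[OF y]
    have "\<forall>\<^sub>F y' in at y within A. f y' \<in> U (ch y)"
      using eventually_U[OF f y openin_U] i by blast
    moreover have "\<forall>\<^sub>F y' in at y within A. y' \<in> A" by (simp add: eventually_at_filter)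
    ultimately show ?thesis
      using flat_onD(3)[OF h1 y i] flat_onD(3)[OF h2 y i]
      by eventually_elim (use c i y in simp)
  qed
  then have const: "c y = c y'" if "y \<in> A" "y' \<in> A" for y y'
    using connected_local_const[OF A that, of c] by blast
  from False obtain y0 where y0: "y0 \<in> A" by blast
  show ?thesis
  proof (intro bexI[of _ "c y0"] ballI impI)
    show "c y0 \<in> S"
      unfolding c_def using flat_onD(1)[OF h1 y0 ch[OF y0]] flat_onD(1)[OF h2 y0 ch[OF y0]] S_inv S_comp
      by blast
    fix y i assume y: "y \<in> A" "i \<in> I" "f y \<in> U i"
    have "bij (h2 i y)" using flat_onD(1)[OF h2 y] S_bij by blast
    then have "c y \<circ> h2 i y = h1 i y"
      by (simp add: c[OF y] comp_assoc bij_is_inj inj_iff[THEN iffD1])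
    then show "h1 i y = c y0 \<circ> h2 i y" using const[OF y0 y(1)] by simp
  qed
qed

text \<open>On a connected overlap the two sections differ by a constant left factor, which is
  absorbed by correcting the second one.\<close>

lemma flat_on_glue:
  assumes f: "continuous_map (top_of_set (A \<union> B)) X f" and A: "closed A" and B: "closed B"
    and conn: "connected (A \<inter> B)"
    and h1: "flat_on A f h1" and h2: "flat_on B f h2"
  shows "\<exists>h. flat_on (A \<union> B) f h"
proof -
  have sub: "flat_on (A \<inter> B) f h1" "flat_on (A \<inter> B) f h2"
    using flat_on_compose[OF h1 continuous_on_id, of "A \<inter> B"]
      flat_on_compose[OF h2 continuous_on_id, of "A \<inter> B"] by auto
  have "continuous_map (top_of_set (A \<inter> B)) X f"
    using f by (rule continuous_map_from_subtopology_mono) blast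
  from flat_on_unique[OF this conn sub] obtain c where c: "c \<in> S"
    "\<forall>y\<in>A \<inter> B. \<forall>i\<in>I. f y \<in> U i \<longrightarrow> h1 i y = c \<circ> h2 i y" by blast
  have "flat_on (A \<union> B) f (\<lambda>i y. if y \<in> A then h1 i y else c \<circ> h2 i y)"
    by (rule flat_on_union[OF f A B h1 flat_on_left_mult[OF h2 c(1)]]) (use c in blast)
  then show ?thesis by blast
qed

section \<open>Existence of flat sections over squares and paths\<close>

lemma flat_on_small_box:
  fixes f :: "real \<times> real \<Rightarrow> 'm"
  assumes f: "continuous_map (top_of_set ({0..1} \<times> {0..1})) X f" and ts: "t \<in> {0..1}" "s \<in> {0..1}"
  obtains d where "d > 0"
    "\<And>a b a' b'. \<lbrakk>0 \<le> a; b \<le> 1; 0 \<le> a'; b' \<le> 1; a \<le> t; t \<le> b; b - a < d; a' \<le> s; s \<le> b'; b' - a' < d\<rbrakk>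
      \<Longrightarrow> \<exists>h. flat_on ({a..b} \<times> {a'..b'}) f h"
proof -
  have "f (t, s) \<in> topspace X" using f ts by (auto simp: continuous_map_def)
  then obtain i where i: "i \<in> I" "f (t, s) \<in> U i" using cover by blast
  have "openin (top_of_set ({0..1} \<times> {0..1})) {x \<in> topspace (top_of_set ({0..1} \<times> {0..1})). f x \<in> U i}"
    using f openin_U[OF i(1)] by (rule openin_continuous_map_preimage)
  then obtain W where W: "open W" "{x \<in> {0..1} \<times> {0..1}. f x \<in> U i} = {0..1} \<times> {0..1} \<inter> W"
    by (auto simp: openin_open)
  have "(t, s) \<in> W" using W(2) i ts by blast
  then obtain A B where AB: "open A" "open B" "t \<in> A" "s \<in> B" "A \<times> B \<subseteq> W"
    using W(1) by (metis open_prod_elim mem_Sigma_iff)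
  obtain d1 d2 where d: "d1 > 0" "d2 > 0" "ball t d1 \<subseteq> A" "ball s d2 \<subseteq> B"
    using AB by (meson openE)
  show thesis
  proof (rule that[of "min d1 d2"])
    fix a b a' b' :: real
    assume *: "0 \<le> a" "b \<le> 1" "0 \<le> a'" "b' \<le> 1" "a \<le> t" "t \<le> b" "b - a < min d1 d2"
      "a' \<le> s" "s \<le> b'" "b' - a' < min d1 d2"
    have "{a..b} \<subseteq> ball t d1" "{a'..b'} \<subseteq> ball s d2"
      using * by (auto simp: dist_real_def)
    then have 1: "{a..b} \<times> {a'..b'} \<subseteq> W" using AB d by blast
    have 2: "{a..b} \<times> {a'..b'} \<subseteq> {0..1} \<times> {0..1}" using * by auto
    with 1 W(2) have "f ` ({a..b} \<times> {a'..b'}) \<subseteq> U i" by blast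
    from flat_on_single[OF continuous_map_from_subtopology_mono[OF f 2] i(1) this]
    show "\<exists>h. flat_on ({a..b} \<times> {a'..b'}) f h" by blast
  qed (use d in auto)
qed

text \<open>Two nested bisections: boxes inside one chart are glued to thin strips of full height,
  and the strips to the square. All overlaps are segments, hence connected.\<close>

lemma flat_on_square_exists:
  fixes f :: "real \<times> real \<Rightarrow> 'm"
  assumes f: "continuous_map (top_of_set ({0..1} \<times> {0..1})) X f"
  shows "\<exists>h. flat_on ({0..1} \<times> {0..1}) f h"
proof -
  let ?P = "\<lambda>a b a' b'. \<exists>h. flat_on ({a..b} \<times> {a'..b'}) f h"
  have glue_t: "?P a c a' b'" if "?P a b a' b'" "?P b c a' b'" "a \<le> b" "b \<le> c" "0 \<le> a" "c \<le> 1" "0 \<le> a'" "b' \<le> 1"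
    for a b c a' b'
  proof -
    have U: "{a..c} \<times> {a'..b'} = {a..b} \<times> {a'..b'} \<union> {b..c} \<times> {a'..b'}" using that by auto
    have Int: "({a..b} \<times> {a'..b'}) \<inter> ({b..c} \<times> {a'..b'}) = {b} \<times> {a'..b'}" using that by auto
    have "{a..b} \<times> {a'..b'} \<union> {b..c} \<times> {a'..b'} \<subseteq> {0..1} \<times> {0..1}" using that by auto
    from flat_on_glue[OF continuous_map_from_subtopology_mono[OF f this]] that(1,2) show ?thesis
      unfolding U Int by (auto intro!: closed_Times connected_Times)
  qed
  have glue_s: "?P a b a' c" if "?P a b a' b'" "?P a b b' c" "a' \<le> b'" "b' \<le> c" "0 \<le> a" "b \<le> 1" "0 \<le> a'" "c \<le> 1"
    for a b c a' b'
  proof -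
    have U: "{a..b} \<times> {a'..c} = {a..b} \<times> {a'..b'} \<union> {a..b} \<times> {b'..c}" using that by auto
    have Int: "({a..b} \<times> {a'..b'}) \<inter> ({a..b} \<times> {b'..c}) = {a..b} \<times> {b'}" using that by auto
    have "{a..b} \<times> {a'..b'} \<union> {a..b} \<times> {b'..c} \<subseteq> {0..1} \<times> {0..1}" using that by auto
    from flat_on_glue[OF continuous_map_from_subtopology_mono[OF f this]] that(1,2) show ?thesis
      unfolding U Int by (auto intro!: closed_Times connected_Times)
  qed
  have strip: "\<exists>d>0. \<forall>a b. 0 \<le> a \<and> b \<le> 1 \<and> a \<le> t \<and> t \<le> b \<and> b - a < d \<longrightarrow> ?P a b 0 1"
    if t: "t \<in> {0..1}" for t
  proof -
    \<comment> \<open>The admissible width \<open>d\<close> may depend on the height interval;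
      joining two intervals takes the minimum of the two widths, which stays positive.\<close>
    let ?Q = "\<lambda>a' b'. 0 \<le> a' \<and> b' \<le> 1 \<longrightarrow>
      (\<exists>d>0. \<forall>a b. 0 \<le> a \<and> b \<le> 1 \<and> a \<le> t \<and> t \<le> b \<and> b - a < d \<longrightarrow> ?P a b a' b')"
    have "?Q 0 1"
    proof (rule Bolzano[where P = ?Q])
      fix a' b' c :: real
      assume Q: "?Q a' b'" "?Q b' c" and le: "a' \<le> b'" "b' \<le> c"
      show "?Q a' c"
      proof
        assume ac: "0 \<le> a' \<and> c \<le> 1"
        with le have "0 \<le> a' \<and> b' \<le> 1" "0 \<le> b' \<and> c \<le> 1" by auto
        with Q obtain d1 d2 where d: "d1 > 0" "d2 > 0"
          "\<forall>a b. 0 \<le> a \<and> b \<le> 1 \<and> a \<le> t \<and> t \<le> b \<and> b - a < d1 \<longrightarrow> ?P a b a' b'"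
          "\<forall>a b. 0 \<le> a \<and> b \<le> 1 \<and> a \<le> t \<and> t \<le> b \<and> b - a < d2 \<longrightarrow> ?P a b b' c"
          by blast
        show "\<exists>d>0. \<forall>a b. 0 \<le> a \<and> b \<le> 1 \<and> a \<le> t \<and> t \<le> b \<and> b - a < d \<longrightarrow> ?P a b a' c"
        proof (intro exI[of _ "min d1 d2"] conjI allI impI)
          fix a b assume *: "0 \<le> a \<and> b \<le> 1 \<and> a \<le> t \<and> t \<le> b \<and> b - a < min d1 d2"
          then have "?P a b a' b'" "?P a b b' c" using d(3,4) by simp_all
          then show "?P a b a' c"
            by (rule glue_s) (use * ac le in auto)
        qed (use d in auto)
      qed
    next
      fix s :: real assume "0 \<le> s" "s \<le> 1"
      then have "s \<in> {0..1}" by simp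
      from flat_on_small_box[OF f t this] obtain d where d: "d > 0"
        "\<And>a b a' b'. \<lbrakk>0 \<le> a; b \<le> 1; 0 \<le> a'; b' \<le> 1; a \<le> t; t \<le> b; b - a < d; a' \<le> s; s \<le> b'; b' - a' < d\<rbrakk>
          \<Longrightarrow> ?P a b a' b'" by blast
      then show "\<exists>d>0. \<forall>a' b'. a' \<le> s \<and> s \<le> b' \<and> b' - a' < d \<longrightarrow> ?Q a' b'"
        by (intro exI[of _ d]) auto
    qed simp
    then show ?thesis by simp
  qed
  let ?R = "\<lambda>a b. 0 \<le> a \<and> b \<le> 1 \<longrightarrow> ?P a b 0 1"
  have "?R 0 1"
  proof (rule Bolzano[where P = ?R])
    fix a b c :: real
    assume "?R a b" "?R b c" "a \<le> b" "b \<le> c"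
    then show "?R a c" by (intro impI glue_t[of a b 0 1 c]) auto
  next
    fix t :: real assume "0 \<le> t" "t \<le> 1"
    then obtain d where "d > 0" "\<forall>a b. 0 \<le> a \<and> b \<le> 1 \<and> a \<le> t \<and> t \<le> b \<and> b - a < d \<longrightarrow> ?P a b 0 1"
      using strip[of t] by auto
    then show "\<exists>d>0. \<forall>a b. a \<le> t \<and> t \<le> b \<and> b - a < d \<longrightarrow> ?R a b" by blast
  qed simp
  then show ?thesis by simp
qed

text \<open>A path becomes a map of the square by ignoring the first coordinate; restriction to the
  edge with first coordinate 0 returns to the path.\<close>

lemma flat_on_path_exists:
  assumes g: "pathin X g"
  shows "\<exists>h. flat_on {0..1} g h"
proof -
  have "continuous_map (top_of_set ({0..1} \<times> {0..1})) (top_of_set {0..1}) (snd :: real \<times> real \<Rightarrow> real)"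
    by (auto simp: continuous_on_snd)
  from continuous_map_compose[OF this g[unfolded pathin_def]]
  obtain h where "flat_on ({0..1} \<times> {0..1}) (g \<circ> (snd :: real \<times> real \<Rightarrow> real)) h"
    using flat_on_square_exists by blast
  from flat_on_compose[OF this, of "{0..1}" "\<lambda>s. (0, s)"]
  have "flat_on {0..1} g (\<lambda>i s. h i (0, s))"
    by (simp add: continuous_on_Pair image_subset_iff)
  then show ?thesis by blast
qed

section \<open>Trivial monodromy and the global section\<close>

text \<open>Along a free homotopy of the loop to a constant one, the quotient of the values of a flat section
  at the two ends of the loops does not change.\<close>

lemma flat_on_loop:
  assumes X: "simply_connected_space X" and g: "pathin X g" "g 0 = g 1"
    and h: "flat_on {0..1} g h" and i: "i \<in> I" "g 0 \<in> U i"
  shows "h i 0 = h i 1"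
proof -
  let ?sq = "{0..1} \<times> {0..1} :: (real \<times> real) set"
  have g0: "g 0 \<in> topspace X" using g by (auto simp: pathin_def continuous_map_def)
  then have "pathin X (\<lambda>t. g 0)" by (simp add: pathin_def)
  with X g have "homotopic_with (\<lambda>k. k 0 = k 1) (top_of_set {0..1}) X g (\<lambda>t. g 0)"
    unfolding simply_connected_space_def by blast
  then obtain F where F: "continuous_map (prod_topology (top_of_set {0..1::real}) (top_of_set {0..1})) X F"
    "\<And>s. F (0, s) = g s" "\<And>s. F (1, s) = g 0" "\<And>t. t \<in> {0..1} \<Longrightarrow> F (t, 0) = F (t, 1)"
    unfolding homotopic_with_def by blast
  have cF: "continuous_map (top_of_set ?sq) X F"
    using F(1) by simp
  then obtain K where K: "flat_on ?sq F K" using flat_on_square_exists by blast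
  have pull: "continuous_map (top_of_set {0..1}) X (\<lambda>y. F (\<phi> y))" "flat_on {0..1} (\<lambda>y. F (\<phi> y)) (\<lambda>i y. K i (\<phi> y))"
    if "continuous_on {0..1} \<phi>" "\<phi> ` {0..1} \<subseteq> ?sq" for \<phi> :: "real \<Rightarrow> real \<times> real"
  proof -
    show "flat_on {0..1} (\<lambda>y. F (\<phi> y)) (\<lambda>i y. K i (\<phi> y))"
      using flat_on_compose[OF K that] .
    have "continuous_map (top_of_set {0..1}) (top_of_set ?sq) \<phi>"
      using that by (auto simp: image_subset_iff)
    from continuous_map_compose[OF this cF] show "continuous_map (top_of_set {0..1}) X (\<lambda>y. F (\<phi> y))"
      by (simp add: o_def)
  qed
  have c: "continuous_on {0..1::real} (\<lambda>t. (t, 0::real))" "continuous_on {0..1::real} (\<lambda>t. (t, 1::real))"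
    "continuous_on {0..1::real} (\<lambda>t. (0::real, t))" "continuous_on {0..1::real} (\<lambda>t. (1::real, t))"
    by (auto intro!: continuous_intros)
  have conn: "connected {0..1::real}" by simp
  have K0: "flat_on {0..1} (\<lambda>t. F (t, 0)) (\<lambda>i t. K i (t, 0))" by (rule pull(2)[OF c(1)]) auto
  \<comment> \<open>The loops stay closed during the homotopy, so the edges with second coordinate 0
    and 1 trace the same path. The two restrictions of \<open>K\<close> are thus flat sections along
    one path and differ by a constant \<open>d\<close>.\<close>
  have K1: "flat_on {0..1} (\<lambda>t. F (t, 0)) (\<lambda>i t. K i (t, 1))"
    by (rule flat_on_cong[OF pull(2)[OF c(2)]]) (use F(4) in auto)
  have "continuous_map (top_of_set {0..1}) X (\<lambda>t. F (t, 0))" by (rule pull(1)[OF c(1)]) auto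
  from flat_on_unique[OF this conn K1 K0] obtain d where d: "d \<in> S"
    "\<And>t i. t \<in> {0..1} \<Longrightarrow> i \<in> I \<Longrightarrow> F (t, 0) \<in> U i \<Longrightarrow> K i (t, 1) = d \<circ> K i (t, 0)" by metis
  have "flat_on {0..1} (\<lambda>s. F (1, s)) (\<lambda>i s. K i (1, s))" by (rule pull(2)[OF c(4)]) auto
  then have loc: "\<forall>s\<in>{0..1}. \<forall>\<^sub>F s' in at s within {0..1}. K i (1, s) = K i (1, s')"
    using i F(3) by (auto dest!: flat_onD(3) simp: eq_commute)
  have "K i (1, 0) = K i (1, 1)"
    by (rule connected_local_const[OF conn _ _ loc]) auto
  \<comment> \<open>At homotopy time 1 the loop is constant and \<open>K i\<close> takes a single
    value on that edge. This evaluates \<open>d\<close>, which is the same at time 0.\<close>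
  with d(2)[of 1 i] i F(3) have "K i (1, 0) = d \<circ> K i (1, 0)" by simp
  moreover have "bij (K i (1, 0))"
    using flat_onD(1)[OF K, of "(1, 0)" i] i F(3) S_bij by simp
  ultimately have "d = id"
    by (metis bij_is_surj comp_id id_comp o_assoc surj_iff)
  with d(2)[of 0 i] i F(2) have eq: "K i (0, 0) = K i (0, 1)" by simp
  have Kg: "flat_on {0..1} g (\<lambda>i s. K i (0, s))"
    using pull(2)[OF c(3)] F(2) by (simp add: image_subset_iff)
  obtain e where "e \<in> S" "\<And>t i. t \<in> {0..1} \<Longrightarrow> i \<in> I \<Longrightarrow> g t \<in> U i \<Longrightarrow> h i t = e \<circ> K i (0, t)"
    using flat_on_unique[OF g(1)[unfolded pathin_def] conn h Kg] by metis
  with i g eq show ?thesis by simp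
qed

lemma flat_on_join:
  assumes g: "pathin X g" "flat_on {0..1} g h" and g': "pathin X g'" "flat_on {0..1} g' h'"
    and eq: "g 1 = g' 0" and i: "i \<in> I" "g 1 \<in> U i" "h i 1 = h' i 0"
  obtains g'' h'' where "pathin X g''" "flat_on {0..1} g'' h''" "g'' 0 = g 0" "g'' 1 = g' 1"
    "\<And>j. h'' j 0 = h j 0" "\<And>j. h'' j 1 = h' j 1"
proof -
  define g'' where "g'' t = (if t \<le> 1/2 then g (2*t) else g' (2*t - 1))" for t :: real
  define h'' where "h'' j t = (if t \<in> {0..1/2} then h j (2*t) else h' j (2*t - 1))" for j and t :: real
  have c: "continuous_on {0..1/2} (\<lambda>t::real. 2*t)" "continuous_on {1/2..1} (\<lambda>t::real. 2*t - 1)"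
    by (auto intro!: continuous_intros)
  have im: "(\<lambda>t::real. 2*t) ` {0..1/2} \<subseteq> {0..1}" "(\<lambda>t::real. 2*t - 1) ` {1/2..1} \<subseteq> {0..1}" by auto
  have top: "continuous_map (top_of_set {0..1/2}) (top_of_set {0..1}) (\<lambda>t::real. 2*t)"
      "continuous_map (top_of_set {1/2..1}) (top_of_set {0..1}) (\<lambda>t::real. 2*t - 1)"
    using c by auto
  have path: "pathin X g''"
    unfolding pathin_def g''_def
  proof (rule continuous_map_cases_le)
    show "continuous_map (subtopology (top_of_set {0..1}) {x \<in> topspace (top_of_set {0..1}). x \<le> 1/2}) X (\<lambda>x. g (2 * x))"
    proof -
      have "{0..1} \<inter> {x::real. 0 \<le> x \<and> x \<le> 1 \<and> x \<le> 1/2} = {0..1/2}" by auto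
      then show ?thesis
        using continuous_map_compose[OF top(1) g(1)[unfolded pathin_def]]
        by (simp add: subtopology_subtopology o_def)
    qed
    show "continuous_map (subtopology (top_of_set {0..1}) {x \<in> topspace (top_of_set {0..1}). 1/2 \<le> x}) X (\<lambda>x. g' (2 * x - 1))"
    proof -
      have "{0..1} \<inter> {x::real. 0 \<le> x \<and> x \<le> 1 \<and> 1/2 \<le> x} = {1/2..1}" by auto
      then show ?thesis
        using continuous_map_compose[OF top(2) g'(1)[unfolded pathin_def]]
        by (simp add: subtopology_subtopology o_def)
    qed
    fix t :: real assume "t \<in> topspace (top_of_set {0..1})" "t = 1/2"
    then have t: "2 * t = 1" by simp
    show "g (2 * t) = g' (2 * t - 1)" unfolding t using eq by simp
  qed auto
  \<comment> \<open>Agreement at the junction in the one chart \<open>i\<close> spreads to all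
    charts, because both sections obey the same transition law there.\<close>
  have eq_all: "h j 1 = h' j 0" if "j \<in> I" "g 1 \<in> U j" for j
  proof -
    have "h j 1 = h i 1 \<circ> k j i (g 1)" "h' j 0 = h' i 0 \<circ> k j i (g' 0)"
      using flat_onD(2)[OF g(2) _ that i(1,2)] flat_onD(2)[OF g'(2) _ that[unfolded eq] i(1,2)[unfolded eq]]
      by simp_all
    then show ?thesis using i(3) eq by simp
  qed
  have mid: "g (2 * t) = g' (2 * t - 1)" if "t * 2 = 1" for t :: real
  proof -
    from that have t: "2 * t = 1" by simp
    show ?thesis unfolding t using eq by simp
  qed
  have U: "{0..1/2} \<union> {1/2..1} = {0..1::real}" by auto
  have "flat_on ({0..1/2} \<union> {1/2..1}) g'' h''"
    unfolding h''_def
  proof (rule flat_on_union)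
    show "continuous_map (top_of_set ({0..1/2} \<union> {1/2..1})) X g''"
      using path unfolding pathin_def U .
    show "flat_on {0..1/2} g'' (\<lambda>i x. h i (2 * x))"
      by (rule flat_on_cong[OF flat_on_compose[OF g(2) c(1) im(1)]]) (auto simp: g''_def)
    show "flat_on {1/2..1} g'' (\<lambda>i x. h' i (2 * x - 1))"
      by (rule flat_on_cong[OF flat_on_compose[OF g'(2) c(2) im(2)]]) (auto simp: g''_def mid)
    fix y j assume *: "y \<in> {0..1/2::real}" "y \<in> {1/2..1}" "j \<in> I" "g'' y \<in> U j"
    then have y: "2 * y = 1" by simp
    have "g 1 \<in> U j" using * y by (simp add: g''_def)
    then show "h j (2 * y) = h' j (2 * y - 1)"
      unfolding y using eq_all[OF *(3)] by simp
  qed auto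
  then show thesis
    using that[of g'' h''] path unfolding U by (auto simp: g''_def h''_def)
qed

text \<open>Run along \<open>g\<close> and back along \<open>g'\<close>, multiplying
  \<open>h'\<close> on the left by the factor \<open>c\<close> that makes the sections meet at the
  turning point. Closing the loop forces \<open>c = id\<close>.\<close>

lemma flat_on_path_unique:
  assumes X: "simply_connected_space X"
    and g: "pathin X g" "flat_on {0..1} g h" and g': "pathin X g'" "flat_on {0..1} g' h'"
    and start: "g 0 = g' 0" "i0 \<in> I" "g 0 \<in> U i0" "h i0 0 = h' i0 0"
    and fin: "g 1 = g' 1" "i \<in> I" "g 1 \<in> U i"
  shows "h i 1 = h' i 1"
proof -
  define c where "c = h i 1 \<circ> inv (h' i 1)"
  have S: "h i 1 \<in> S" "h' i 1 \<in> S" "h' i0 0 \<in> S"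
    using flat_onD(1)[OF g(2)] flat_onD(1)[OF g'(2)] start fin by auto
  then have c: "c \<in> S" unfolding c_def using S_inv S_comp by blast
  have c1: "c \<circ> h' i 1 = h i 1"
    unfolding c_def using S_bij[OF S(2)] by (simp add: comp_assoc bij_is_inj inj_iff[THEN iffD1])
  have rev: "continuous_on {0..1} (\<lambda>t::real. 1 - t)" "(\<lambda>t::real. 1 - t) ` {0..1} \<subseteq> {0..1}"
    by (auto intro!: continuous_intros)
  have "continuous_map (top_of_set {0..1}) (top_of_set {0..1}) (\<lambda>t::real. 1 - t)"
    using rev(1) by auto
  from continuous_map_compose[OF this g'(1)[unfolded pathin_def]]
  have r: "pathin X (\<lambda>t. g' (1 - t))" by (simp add: pathin_def o_def)
  have fr: "flat_on {0..1} (\<lambda>t. g' (1 - t)) (\<lambda>i t. c \<circ> h' i (1 - t))"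
    using flat_on_compose[OF flat_on_left_mult[OF g'(2) c] rev] .
  obtain g'' h'' where j: "pathin X g''" "flat_on {0..1} g'' h''" "g'' 0 = g 0" "g'' 1 = g' (1 - 1)"
    "\<And>j. h'' j 0 = h j 0" "\<And>j. h'' j 1 = c \<circ> h' j (1 - 1)"
    by (rule flat_on_join[OF g r fr]) (use fin c1 in auto)
  have "h'' i0 0 = h'' i0 1"
    by (rule flat_on_loop[OF X j(1) _ j(2) start(2)]) (use j(3,4) start in auto)
  with j(5,6) start have "h' i0 0 = c \<circ> h' i0 0" by simp
  then have "c = id"
    using S_bij[OF S(3)] by (metis bij_is_surj comp_id o_assoc surj_iff)
  with c1 show ?thesis by simp
qed

lemma global_flat_section:
  assumes X: "locally_path_connected_space X" "connected_space X" "simply_connected_space X"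
  shows "\<exists>H. \<forall>i\<in>I. \<forall>m\<in>U i. H i m \<in> S \<and> (\<forall>j\<in>I. m \<in> U j \<longrightarrow> H i m = H j m \<circ> k i j m) \<and>
    (\<exists>V. openin X V \<and> m \<in> V \<and> (\<forall>m'\<in>V. H i m' = H i m))"
proof (cases "\<exists>i0 m0. i0 \<in> I \<and> m0 \<in> U i0")
  case False
  then show ?thesis by blast
next
  case True
  then obtain i0 m0 where i0: "i0 \<in> I" "m0 \<in> U i0" by blast
  have UX: "m \<in> topspace X" if "i \<in> I" "m \<in> U i" for i m
    using openin_subset[OF openin_U] that by blast
  \<comment> \<open>\<open>\<phi>\<close> is the value at \<open>m\<close>, in chart
    \<open>i\<close>, of a section transported from \<open>m0\<close>, where it is normalized to
    \<open>id\<close> in chart \<open>i0\<close>.\<close>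
  define R where "R i m \<phi> \<longleftrightarrow> (\<exists>g h. pathin X g \<and> flat_on {0..1} g h \<and> g 0 = m0 \<and> g 1 = m \<and>
    h i0 0 = id \<and> h i 1 = \<phi>)" for i m \<phi>
  have R_unique: "\<phi> = \<psi>" if "R i m \<phi>" "R i m \<psi>" "i \<in> I" "m \<in> U i" for i m \<phi> \<psi>
  proof -
    from that(1) obtain g h where g: "pathin X g" "flat_on {0..1} g h" "g 0 = m0" "g 1 = m"
      "h i0 0 = id" "h i 1 = \<phi>" unfolding R_def by blast
    from that(2) obtain g' h' where g': "pathin X g'" "flat_on {0..1} g' h'" "g' 0 = m0" "g' 1 = m"
      "h' i0 0 = id" "h' i 1 = \<psi>" unfolding R_def by blast
    have "h i 1 = h' i 1"
      by (rule flat_on_path_unique[OF X(3) g(1,2) g'(1,2) _ i0(1) _ _ _ that(3)])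
        (use g g' i0 that(4) in auto)
    then show ?thesis using g g' by simp
  qed
  have R_exists: "\<exists>g h. pathin X g \<and> flat_on {0..1} g h \<and> g 0 = m0 \<and> g 1 = m \<and> h i0 0 = id"
    if "i \<in> I" "m \<in> U i" for i m
  proof -
    have "path_connected_space X" using X path_connected_eq_connected_space by blast
    moreover have "m0 \<in> topspace X" "m \<in> topspace X" using UX i0 that by auto
    ultimately obtain g where g: "pathin X g" "g 0 = m0" "g 1 = m"
      unfolding path_connected_space_def by blast
    obtain h where h: "flat_on {0..1} g h" using flat_on_path_exists g(1) by blast
    have S: "h i0 0 \<in> S" using flat_onD(1)[OF h] g i0 by simp
    have "flat_on {0..1} g (\<lambda>i y. inv (h i0 0) \<circ> h i y)"
      using flat_on_left_mult[OF h S_inv[OF S]] .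
    moreover have "inv (h i0 0) \<circ> h i0 0 = id"
      using S_bij[OF S] by (simp add: bij_is_inj)
    ultimately show ?thesis using g by blast
  qed
  define H where "H i m = (THE \<phi>. R i m \<phi>)" for i m
  have H: "H i m = \<phi>" if "R i m \<phi>" "i \<in> I" "m \<in> U i" for i m \<phi>
    unfolding H_def using R_unique that by blast
  show ?thesis
  proof (intro exI[of _ H] ballI)
    fix i m assume i: "i \<in> I" "m \<in> U i"
    then obtain g h where g: "pathin X g" "flat_on {0..1} g h" "g 0 = m0" "g 1 = m" "h i0 0 = id"
      using R_exists by blast
    \<comment> \<open>One path and one section evaluate \<open>H\<close> at \<open>m\<close> in
      every chart, so the transition law of \<open>h\<close> at its endpoint becomes that of
      \<open>H\<close>.\<close>
    have eq: "H j m = h j 1" if "j \<in> I" "m \<in> U j" for j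
      using that g by (intro H) (auto simp: R_def)
    have hS: "h i 1 \<in> S" and hk: "\<And>j. j \<in> I \<Longrightarrow> m \<in> U j \<Longrightarrow> h i 1 = h j 1 \<circ> k i j m"
      using flat_onD(1,2)[OF g(2) _ i(1), of 1, unfolded g(4), OF _ i(2)] by simp_all
    obtain V where V: "openin X V" "path_connectedin X V" "m \<in> V" "V \<subseteq> U i"
      using X(1) openin_U[OF i(1)] i(2) unfolding locally_path_connected_space by blast
    have "H i m' = H i m" if m': "m' \<in> V" for m'
    proof -
      obtain p where p: "pathin X p" "p ` {0..1} \<subseteq> V" "p 0 = m" "p 1 = m'"
        using V(2,3) m' unfolding path_connectedin by blast
      have "p ` {0..1} \<subseteq> U i" using p(2) V(4) by blast
      from flat_on_single[OF p(1)[unfolded pathin_def] i(1) this]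
      have fp: "flat_on {0..1} p (\<lambda>j t. k j i (p t))" .
      \<comment> \<open>An idempotent bijection is the identity. Hence the section continued along
        \<open>p\<close> keeps the value \<open>h i 1\<close> in chart \<open>i\<close> at the end
        of \<open>p\<close>, which gives local constancy of \<open>H i\<close>.\<close>
      have kii: "k i i x = id" if "x \<in> U i" for x
      proof -
        have "bij (k i i x)" "k i i x = k i i x \<circ> k i i x"
          using k_in[of i i x] k_cocycle[of i i i x] S_bij i that by blast+
        then show ?thesis by (metis bij_is_surj comp_id o_assoc surj_iff)
      qed
      have fp': "flat_on {0..1} p (\<lambda>j t. h i 1 \<circ> k j i (p t))"
        using flat_on_left_mult[OF fp hS] .
      have "k i i (p 0) = id" "k i i (p 1) = id"
        using kii p V m' by auto
      then have start: "h i 1 = h i 1 \<circ> k i i (p 0)" "h i 1 \<circ> k i i (p 1) = h i 1" by simp_all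
      have gp: "g 1 = p 0" and gU: "g 1 \<in> U i" using p g i by simp_all
      obtain g'' h'' where j: "pathin X g''" "flat_on {0..1} g'' h''" "g'' 0 = g 0" "g'' 1 = p 1"
        "\<And>j. h'' j 0 = h j 0" "\<And>j. h'' j 1 = h i 1 \<circ> k j i (p 1)"
        by (rule flat_on_join[OF g(1,2) p(1) fp' gp i(1) gU start(1)]) (rule that)
      have "R i m' (h i 1)"
        unfolding R_def
        by (rule exI[of _ g''], rule exI[of _ h'']) (use j g p start in auto)
      then show ?thesis using H i eq m' V by auto
    qed
    with V show "H i m \<in> S \<and> (\<forall>j\<in>I. m \<in> U j \<longrightarrow> H i m = H j m \<circ> k i j m) \<and>
      (\<exists>V. openin X V \<and> m \<in> V \<and> (\<forall>m'\<in>V. H i m' = H i m))"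
      using eq i hS hk by metis
  qed
qed

end

section \<open>Developing maps of quasi-Hessian manifolds\<close>

text \<open>Small balls in a parameter domain are path connected, and the parametrization is a
  homeomorphism onto a relatively open set.\<close>

lemma embedded_submanifold_nbhd:
  fixes L :: "'n::finite pt set"
  assumes L: "embedded_submanifold L" and V: "openin (top_of_set L) V" "x \<in> V"
  shows "\<exists>U. openin (top_of_set L) U \<and> path_connected U \<and> x \<in> U \<and> U \<subseteq> V"
proof -
  have "x \<in> L" using V openin_imp_subset by blast
  from bspec[OF L[unfolded embedded_submanifold_def] this] obtain W :: "(real^'n) set" and \<psi> \<phi> where W: "open W" "x \<in> \<psi> ` W"
    "openin (top_of_set L) (\<psi> ` W)" "homeomorphism W (\<psi> ` W) \<psi> \<phi>"
    by (elim exE conjE)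
  then obtain u where u: "u \<in> W" "\<psi> u = x" by blast
  have cont: "continuous_on W \<psi>" using W(4) by (simp add: homeomorphism_def)
  obtain V' where V': "open V'" "V = L \<inter> V'" using V(1) by (auto simp: openin_open)
  have "open (W \<inter> \<psi> -` V')" using continuous_open_preimage[OF cont W(1) V'(1)] .
  moreover have "u \<in> W \<inter> \<psi> -` V'" using u V V' by blast
  ultimately obtain e where e: "e > 0" "ball u e \<subseteq> W \<inter> \<psi> -` V'" by (meson openE)
  have "openin (top_of_set W) (ball u e)" using e by (auto intro: open_subset)
  from homeomorphism_imp_open_map[OF W(4) this] W(3)
  have "openin (top_of_set L) (\<psi> ` ball u e)" by (rule openin_trans)
  moreover have "path_connected (\<psi> ` ball u e)"
    using e(2) by (intro path_connected_continuous_image continuous_on_subset[OF cont])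
      (auto simp: convex_imp_path_connected)
  moreover have "x \<in> \<psi> ` ball u e" using u(2) e(1) by force
  moreover have "\<psi> ` ball u e \<subseteq> V"
    using e(2) V'(2) openin_imp_subset[OF W(3)] by blast
  ultimately show ?thesis by blast
qed

lemma path_connectedin_euclidean_iff:
  "path_connectedin euclidean S \<longleftrightarrow> path_connected (S :: 'a::topological_space set)"
  unfolding path_connectedin path_connected_def path_def pathin_def path_image_def pathstart_def pathfinish_def
  by (simp add: image_subset_iff_funcset)

lemma locally_path_connected_space_embedded_submanifold:
  assumes "embedded_submanifold L"
  shows "locally_path_connected_space (top_of_set L)"
  unfolding locally_path_connected_space path_connectedin_subtopology path_connectedin_euclidean_iff
proof (intro allI impI, elim conjE)
  fix V x assume "openin (top_of_set L) V" "x \<in> V"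
  from embedded_submanifold_nbhd[OF assms this]
  show "\<exists>U. openin (top_of_set L) U \<and> (path_connected U \<and> U \<subseteq> L) \<and> x \<in> U \<and> U \<subseteq> V"
    using openin_imp_subset by blast
qed

lemma affine_legendre_continuous:
  fixes F :: "'n::finite pt \<Rightarrow> 'n pt"
  assumes "affine_legendre F"
  shows "continuous_on S F"
proof -
  obtain A B :: "real^'n^'n" and b c d where
    F: "F = (\<lambda>q. (A *v xc q + b, B *v (pc q + c), zc q + c \<bullet> xc q + d))"
    using assms unfolding affine_legendre_iff by blast
  have lin: "continuous_on S xc" "continuous_on S pc" "continuous_on S zc" for S :: "'n pt set"
    using bounded_linear_xc bounded_linear_pc bounded_linear_zc linear_continuous_on by blast+
  show ?thesis
    unfolding F
    by (intro continuous_intros lin linear_continuous_on_compose[OF _ matrix_vector_mul_linear])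
qed

locale quasi_hessian =
  fixes Q :: "('i, 'n::finite, 'm) qh_data"
  assumes qh: "quasi_hessian_manifold Q"
begin

abbreviation "M \<alpha> \<equiv> model Q \<alpha>"

lemmas qh_conj = qh[unfolded quasi_hessian_manifold_def]

lemma model_legendre:
  "\<alpha> \<in> index Q \<Longrightarrow> legendre_submanifold (M \<alpha>)"
  using qh_conj[THEN conjunct2, THEN conjunct1] by blast

lemma overlap_open:
  "\<alpha> \<in> index Q \<Longrightarrow> \<beta> \<in> index Q \<Longrightarrow> openin (top_of_set (M \<alpha>)) (overlap Q \<alpha> \<beta>)"
  using qh_conj[THEN conjunct2, THEN conjunct2, THEN conjunct1] by blast

lemma overlap_self:
  "\<alpha> \<in> index Q \<Longrightarrow> overlap Q \<alpha> \<alpha> = M \<alpha>"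
  using qh_conj[THEN conjunct2, THEN conjunct2, THEN conjunct2, THEN conjunct1] by blast

lemma glue_aff_legendre:
  "\<alpha> \<in> index Q \<Longrightarrow> \<beta> \<in> index Q \<Longrightarrow> x \<in> overlap Q \<alpha> \<beta> \<Longrightarrow>
    affine_legendre (glue_aff Q \<alpha> \<beta> x)"
  using qh_conj[THEN conjunct2, THEN conjunct2, THEN conjunct2, THEN conjunct2, THEN conjunct1] by blast

lemma glue_aff_component:
  "\<alpha> \<in> index Q \<Longrightarrow> \<beta> \<in> index Q \<Longrightarrow> C \<in> components (overlap Q \<alpha> \<beta>) \<Longrightarrow>
    x \<in> C \<Longrightarrow> y \<in> C \<Longrightarrow> glue_aff Q \<alpha> \<beta> x = glue_aff Q \<alpha> \<beta> y"
  using qh_conj[THEN conjunct2, THEN conjunct2, THEN conjunct2, THEN conjunct2, THEN conjunct2, THEN conjunct1] by blast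

lemma glue_bij:
  "\<alpha> \<in> index Q \<Longrightarrow> \<beta> \<in> index Q \<Longrightarrow> bij_betw (glue Q \<alpha> \<beta>) (overlap Q \<alpha> \<beta>) (overlap Q \<beta> \<alpha>)"
  using qh_conj[THEN conjunct2, THEN conjunct2, THEN conjunct2, THEN conjunct2, THEN conjunct2, THEN conjunct2, THEN conjunct1] by blast

lemma glue_cocycle:
  "\<alpha> \<in> index Q \<Longrightarrow> \<beta> \<in> index Q \<Longrightarrow> \<gamma> \<in> index Q \<Longrightarrow> x \<in> overlap Q \<alpha> \<beta> \<Longrightarrow>
    x \<in> overlap Q \<alpha> \<gamma> \<Longrightarrow> glue_aff Q \<alpha> \<gamma> x = glue_aff Q \<beta> \<gamma> (glue Q \<alpha> \<beta> x) \<circ> glue_aff Q \<alpha> \<beta> x"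
  using qh_conj[THEN conjunct2, THEN conjunct2, THEN conjunct2, THEN conjunct2, THEN conjunct2, THEN conjunct2, THEN conjunct2, THEN conjunct1] by blast

lemma incl_quotient:
  "quotient_map (sum_topology (\<lambda>\<alpha>. top_of_set (M \<alpha>)) (index Q)) (glued Q)
    (\<lambda>(\<alpha>, x). incl Q \<alpha> x)"
  using qh_conj[THEN conjunct2, THEN conjunct2, THEN conjunct2, THEN conjunct2, THEN conjunct2, THEN conjunct2, THEN conjunct2, THEN conjunct2, THEN conjunct1] by blast

lemma incl_eq_iff:
  "\<alpha> \<in> index Q \<Longrightarrow> \<beta> \<in> index Q \<Longrightarrow> x \<in> M \<alpha> \<Longrightarrow> y \<in> M \<beta> \<Longrightarrow>
    incl Q \<alpha> x = incl Q \<beta> y \<longleftrightarrow> x \<in> overlap Q \<alpha> \<beta> \<and> y = glue Q \<alpha> \<beta> x"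
  using qh_conj[THEN conjunct2, THEN conjunct2, THEN conjunct2, THEN conjunct2, THEN conjunct2, THEN conjunct2, THEN conjunct2, THEN conjunct2, THEN conjunct2, THEN conjunct1] by blast

section \<open>Inclusions of the local models into the glued space\<close>

lemma overlap_subset: "\<alpha> \<in> index Q \<Longrightarrow> \<beta> \<in> index Q \<Longrightarrow> overlap Q \<alpha> \<beta> \<subseteq> M \<alpha>"
  using overlap_open openin_imp_subset by blast

lemma glue_mem: "\<alpha> \<in> index Q \<Longrightarrow> \<beta> \<in> index Q \<Longrightarrow> x \<in> overlap Q \<alpha> \<beta> \<Longrightarrow> glue Q \<alpha> \<beta> x \<in> overlap Q \<beta> \<alpha>"
  using bij_betwE[OF glue_bij] by simp

lemma incl_glue:
  assumes "\<alpha> \<in> index Q" "\<beta> \<in> index Q" "x \<in> overlap Q \<alpha> \<beta>"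
  shows "incl Q \<beta> (glue Q \<alpha> \<beta> x) = incl Q \<alpha> x"
proof -
  have "x \<in> M \<alpha>" using assms overlap_subset[OF assms(1,2)] by blast
  moreover have "glue Q \<alpha> \<beta> x \<in> M \<beta>"
    using glue_mem[OF assms] overlap_subset[OF assms(2,1)] by blast
  ultimately have "incl Q \<alpha> x = incl Q \<beta> (glue Q \<alpha> \<beta> x)"
    using incl_eq_iff[OF assms(1,2)] assms(3) by simp
  then show ?thesis by simp
qed

text \<open>Write \<open>x\<close> as the image under \<open>glue Q \<alpha> \<alpha>\<close> of
  some \<open>y\<close>; the cocycle condition at \<open>y\<close> then has the same bijection on
  both sides, which cancels.\<close>

lemma glue_aff_self:
  assumes "\<alpha> \<in> index Q" "x \<in> M \<alpha>"
  shows "glue_aff Q \<alpha> \<alpha> x = id"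
proof -
  obtain y where y: "y \<in> M \<alpha>" "glue Q \<alpha> \<alpha> y = x"
    using glue_bij[of \<alpha> \<alpha>] assms overlap_self unfolding bij_betw_def by (metis imageE)
  have "glue_aff Q \<alpha> \<alpha> y = glue_aff Q \<alpha> \<alpha> x \<circ> glue_aff Q \<alpha> \<alpha> y"
    using glue_cocycle[of \<alpha> \<alpha> \<alpha> y] y assms overlap_self by simp
  moreover have "bij (glue_aff Q \<alpha> \<alpha> y)"
    using glue_aff_legendre[of \<alpha> \<alpha> y] y assms overlap_self affine_legendre_inverse(1) by blast
  ultimately show ?thesis by (metis bij_is_surj comp_id o_assoc surj_iff)
qed

lemma incl_inj:
  assumes "\<alpha> \<in> index Q"
  shows "inj_on (incl Q \<alpha>) (M \<alpha>)"
proof (rule inj_onI)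
  fix x y assume "x \<in> M \<alpha>" "y \<in> M \<alpha>" "incl Q \<alpha> x = incl Q \<alpha> y"
  then show "x = y" using incl_eq_iff[of \<alpha> \<alpha> x y] glue_aff_self assms by (simp add: glue_def)
qed

text \<open>The data are constant on components of the overlap; a path connected neighbourhood in
  the submanifold lies inside one component.\<close>

lemma glue_aff_locally_constant:
  assumes "\<alpha> \<in> index Q" "\<beta> \<in> index Q" "x \<in> overlap Q \<alpha> \<beta>"
  shows "\<exists>U. openin (top_of_set (M \<alpha>)) U \<and> x \<in> U \<and> U \<subseteq> overlap Q \<alpha> \<beta> \<and>
    (\<forall>y\<in>U. glue_aff Q \<alpha> \<beta> y = glue_aff Q \<alpha> \<beta> x)"
proof -
  have "embedded_submanifold (M \<alpha>)" using model_legendre assms(1) unfolding legendre_submanifold_def by blast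
  from embedded_submanifold_nbhd[OF this overlap_open[OF assms(1,2)] assms(3)] obtain U where
    U: "openin (top_of_set (M \<alpha>)) U" "path_connected U" "x \<in> U" "U \<subseteq> overlap Q \<alpha> \<beta>" by blast
  have "connected U" using U(2) path_connected_imp_connected by blast
  then have sub: "U \<subseteq> connected_component_set (overlap Q \<alpha> \<beta>) x"
    using U by (intro connected_component_maximal)
  have "connected_component_set (overlap Q \<alpha> \<beta>) x \<in> components (overlap Q \<alpha> \<beta>)"
    using assms(3) componentsI by blast
  then have "\<forall>y\<in>U. glue_aff Q \<alpha> \<beta> y = glue_aff Q \<alpha> \<beta> x"
    using glue_aff_component[OF assms(1,2)] sub U(3) by blast
  with U show ?thesis by blast
qed

text \<open>\<open>glue Q \<alpha> \<beta>\<close> evaluates an equivalence that changes with the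
  component, so continuity is checked near each point, where it is one fixed affine map.\<close>

lemma glue_preimage_open:
  assumes "\<alpha> \<in> index Q" "\<beta> \<in> index Q" and V: "openin (top_of_set (M \<beta>)) V"
  shows "openin (top_of_set (M \<alpha>)) {x \<in> overlap Q \<alpha> \<beta>. glue Q \<alpha> \<beta> x \<in> V}"
proof (subst openin_subopen, intro ballI)
  fix x assume "x \<in> {x \<in> overlap Q \<alpha> \<beta>. glue Q \<alpha> \<beta> x \<in> V}"
  then have x: "x \<in> overlap Q \<alpha> \<beta>" "glue Q \<alpha> \<beta> x \<in> V" by auto
  obtain U where U: "openin (top_of_set (M \<alpha>)) U" "x \<in> U" "U \<subseteq> overlap Q \<alpha> \<beta>"
    "\<forall>y\<in>U. glue_aff Q \<alpha> \<beta> y = glue_aff Q \<alpha> \<beta> x"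
    using glue_aff_locally_constant[OF assms(1,2) x(1)] by blast
  obtain V' where V': "open V'" "V = M \<beta> \<inter> V'" using V by (auto simp: openin_open)
  have "openin (top_of_set U) (U \<inter> glue_aff Q \<alpha> \<beta> x -` V')"
    using affine_legendre_continuous[OF glue_aff_legendre[OF assms(1,2) x(1)]] V'(1)
    by (rule continuous_openin_preimage_gen)
  then have "openin (top_of_set (M \<alpha>)) (U \<inter> glue_aff Q \<alpha> \<beta> x -` V')"
    using U(1) by (rule openin_trans)
  moreover have "x \<in> U \<inter> glue_aff Q \<alpha> \<beta> x -` V'" using U(2) x(2) V'(2) by (simp add: glue_def)
  moreover have "U \<inter> glue_aff Q \<alpha> \<beta> x -` V' \<subseteq> {x \<in> overlap Q \<alpha> \<beta>. glue Q \<alpha> \<beta> x \<in> V}"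
  proof
    fix y assume y: "y \<in> U \<inter> glue_aff Q \<alpha> \<beta> x -` V'"
    then have yo: "y \<in> overlap Q \<alpha> \<beta>" using U(3) by blast
    have "glue Q \<alpha> \<beta> y \<in> M \<beta>" using glue_mem[OF assms(1,2) yo] overlap_subset[OF assms(2,1)] by blast
    moreover have "glue Q \<alpha> \<beta> y \<in> V'" using y U(4) by (simp add: glue_def)
    ultimately show "y \<in> {x \<in> overlap Q \<alpha> \<beta>. glue Q \<alpha> \<beta> x \<in> V}" using yo V'(2) by simp
  qed
  ultimately show "\<exists>T. openin (top_of_set (M \<alpha>)) T \<and> x \<in> T \<and> T \<subseteq> {x \<in> overlap Q \<alpha> \<beta>. glue Q \<alpha> \<beta> x \<in> V}"
    by blast
qed

lemma incl_continuous:
  assumes "\<alpha> \<in> index Q"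
  shows "continuous_map (top_of_set (M \<alpha>)) (glued Q) (incl Q \<alpha>)"
proof -
  have "continuous_map (top_of_set (M \<alpha>)) (sum_topology (\<lambda>\<alpha>. top_of_set (M \<alpha>)) (index Q)) (\<lambda>x. (\<alpha>, x))"
    using continuous_map_component_injection[OF assms, of "\<lambda>\<alpha>. top_of_set (M \<alpha>)"] .
  from continuous_map_compose[OF this quotient_imp_continuous_map[OF incl_quotient]]
  show ?thesis by (simp add: o_def)
qed

text \<open>Openness in a quotient is tested on preimages. In \<open>M \<beta>\<close> the preimage
  is the part of the overlap that \<open>glue Q \<beta> \<alpha>\<close> sends into
  \<open>V\<close>.\<close>

lemma incl_open:
  assumes \<alpha>: "\<alpha> \<in> index Q" and V: "openin (top_of_set (M \<alpha>)) V"
  shows "openin (glued Q) (incl Q \<alpha> ` V)"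
proof -
  let ?S = "sum_topology (\<lambda>\<alpha>. top_of_set (M \<alpha>)) (index Q)"
  let ?f = "\<lambda>(\<alpha>, x). incl Q \<alpha> x"
  have VM: "V \<subseteq> M \<alpha>" using V openin_imp_subset by blast
  have "incl Q \<alpha> ` V \<subseteq> topspace (glued Q)"
    using incl_continuous[OF \<alpha>] VM by (auto simp: continuous_map_def)
  moreover have "openin ?S {p \<in> topspace ?S. ?f p \<in> incl Q \<alpha> ` V}"
    unfolding openin_sum_topology
  proof (intro conjI ballI)
    fix \<beta> assume \<beta>: "\<beta> \<in> index Q"
    have "{x. (\<beta>, x) \<in> {p \<in> topspace ?S. ?f p \<in> incl Q \<alpha> ` V}} = {x \<in> overlap Q \<beta> \<alpha>. glue Q \<beta> \<alpha> x \<in> V}"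
    proof (intro set_eqI iffI)
      fix x assume "x \<in> {x. (\<beta>, x) \<in> {p \<in> topspace ?S. ?f p \<in> incl Q \<alpha> ` V}}"
      then obtain y where y: "x \<in> M \<beta>" "y \<in> V" "incl Q \<beta> x = incl Q \<alpha> y" by auto
      then show "x \<in> {x \<in> overlap Q \<beta> \<alpha>. glue Q \<beta> \<alpha> x \<in> V}"
        using incl_eq_iff[OF \<beta> \<alpha>, of x y] VM by auto
    next
      fix x assume x: "x \<in> {x \<in> overlap Q \<beta> \<alpha>. glue Q \<beta> \<alpha> x \<in> V}"
      then have "incl Q \<beta> x = incl Q \<alpha> (glue Q \<beta> \<alpha> x)" using incl_glue[OF \<beta> \<alpha>] by simp
      with x show "x \<in> {x. (\<beta>, x) \<in> {p \<in> topspace ?S. ?f p \<in> incl Q \<alpha> ` V}}"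
        using \<beta> overlap_subset[OF \<beta> \<alpha>] by auto
    qed
    then show "openin (top_of_set (M \<beta>)) {x. (\<beta>, x) \<in> {p \<in> topspace ?S. ?f p \<in> incl Q \<alpha> ` V}}"
      using glue_preimage_open[OF \<beta> \<alpha> V] by simp
  qed auto
  ultimately show ?thesis using incl_quotient unfolding quotient_map_def by blast
qed

lemma glued_cover:
  assumes "m \<in> topspace (glued Q)"
  obtains \<alpha> x where "\<alpha> \<in> index Q" "x \<in> M \<alpha>" "incl Q \<alpha> x = m"
proof -
  have "(\<lambda>(\<alpha>, x). incl Q \<alpha> x) ` topspace (sum_topology (\<lambda>\<alpha>. top_of_set (M \<alpha>)) (index Q)) = topspace (glued Q)"
    using incl_quotient unfolding quotient_map_def by blast
  with assms show thesis using that by force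
qed

lemma locally_path_connected_glued: "locally_path_connected_space (glued Q)"
proof (rule locally_path_connected_space_quotient_map_image[OF incl_quotient])
  have "locally_path_connected_space (top_of_set (M \<alpha>))" if "\<alpha> \<in> index Q" for \<alpha>
    using model_legendre[OF that] locally_path_connected_space_embedded_submanifold
    unfolding legendre_submanifold_def by blast
  then show "locally_path_connected_space (sum_topology (\<lambda>\<alpha>. top_of_set (M \<alpha>)) (index Q))"
    unfolding locally_path_connected_space_sum_topology by blast
qed

section \<open>The gluing cocycle and the developing map\<close>

definition coord :: "'i \<Rightarrow> 'm \<Rightarrow> 'n pt" where "coord \<alpha> = inv_into (M \<alpha>) (incl Q \<alpha>)"

lemma coord_incl: "\<alpha> \<in> index Q \<Longrightarrow> x \<in> M \<alpha> \<Longrightarrow> coord \<alpha> (incl Q \<alpha> x) = x"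
  by (simp add: coord_def incl_inj inv_into_f_f)

sublocale flat_cocycle "glued Q" "index Q" "\<lambda>\<alpha>. incl Q \<alpha> ` M \<alpha>" "Collect affine_legendre"
  "\<lambda>\<alpha> \<beta> m. glue_aff Q \<alpha> \<beta> (coord \<alpha> m)"
proof
  \<comment> \<open>A point in two chart images has coordinates in the overlap that correspond under
    \<open>glue\<close>; this translates the gluing axioms into statements about points of the glued
    space.\<close>
  have ov: "coord \<alpha> m \<in> overlap Q \<alpha> \<beta> \<and> coord \<beta> m = glue Q \<alpha> \<beta> (coord \<alpha> m) \<and> incl Q \<alpha> (coord \<alpha> m) = m"
    if ab: "\<alpha> \<in> index Q" "\<beta> \<in> index Q" and m: "m \<in> incl Q \<alpha> ` M \<alpha>" "m \<in> incl Q \<beta> ` M \<beta>" for \<alpha> \<beta> m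
  proof -
    obtain x y where "x \<in> M \<alpha>" "y \<in> M \<beta>" "m = incl Q \<alpha> x" "m = incl Q \<beta> y" using m by blast
    then show ?thesis using coord_incl[OF ab(1), of x] coord_incl[OF ab(2), of y] incl_eq_iff[OF ab, of x y] by auto
  qed
  show "openin (glued Q) (incl Q i ` M i)" if "i \<in> index Q" for i
    using incl_open[OF that] by simp
  show "\<exists>i\<in>index Q. m \<in> incl Q i ` M i" if "m \<in> topspace (glued Q)" for m
    using glued_cover[OF that] by blast
  show "bij f" "inv f \<in> Collect affine_legendre" if "f \<in> Collect affine_legendre" for f :: "'n pt \<Rightarrow> 'n pt"
    using that affine_legendre_inverse by auto
  show "id \<in> Collect affine_legendre" by (simp add: affine_legendre_id)
  show "f \<circ> g \<in> Collect affine_legendre" if "f \<in> Collect affine_legendre" "g \<in> Collect affine_legendre"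
    for f g :: "'n pt \<Rightarrow> 'n pt"
    using that affine_legendre_comp by auto
  fix i j m assume ij: "i \<in> index Q" "j \<in> index Q"
  show "glue_aff Q i j (coord i m) \<in> Collect affine_legendre" if "m \<in> incl Q i ` M i" "m \<in> incl Q j ` M j"
    using ov[OF ij that] glue_aff_legendre[OF ij] by simp
  show "glue_aff Q i l (coord i m) = glue_aff Q j l (coord j m) \<circ> glue_aff Q i j (coord i m)"
    if "l \<in> index Q" "m \<in> incl Q i ` M i" "m \<in> incl Q j ` M j" "m \<in> incl Q l ` M l" for l
  proof -
    have "coord i m \<in> overlap Q i j" "coord j m = glue Q i j (coord i m)" "coord i m \<in> overlap Q i l"
      using ov[OF ij that(2,3)] ov[OF ij(1) that(1,2,4)] by auto
    then show ?thesis using glue_cocycle[OF ij that(1)] by simp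
  qed
  show "\<exists>V. openin (glued Q) V \<and> m \<in> V \<and> (\<forall>m'\<in>V. glue_aff Q i j (coord i m') = glue_aff Q i j (coord i m))"
    if "m \<in> incl Q i ` M i" "m \<in> incl Q j ` M j"
  proof -
    note o = ov[OF ij that]
    obtain U where U: "openin (top_of_set (M i)) U" "coord i m \<in> U" "U \<subseteq> overlap Q i j"
      "\<forall>y\<in>U. glue_aff Q i j y = glue_aff Q i j (coord i m)"
      using glue_aff_locally_constant[OF ij] o by blast
    have "m \<in> incl Q i ` U" using U(2) o by force
    moreover have "\<forall>m'\<in>incl Q i ` U. glue_aff Q i j (coord i m') = glue_aff Q i j (coord i m)"
      using U(3,4) coord_incl[OF ij(1)] overlap_subset[OF ij] by auto
    ultimately show ?thesis using incl_open[OF ij(1) U(1)] by blast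
  qed
qed

lemma developing_map_exists:
  assumes conn: "connected_space (glued Q)" and simply: "simply_connected_space (glued Q)"
  shows "\<exists>X. developing_map Q X"
proof -
  from global_flat_section[OF locally_path_connected_glued conn simply]
  obtain H where H: "\<forall>\<alpha>\<in>index Q. \<forall>m\<in>incl Q \<alpha> ` M \<alpha>. H \<alpha> m \<in> Collect affine_legendre \<and>
      (\<forall>\<beta>\<in>index Q. m \<in> incl Q \<beta> ` M \<beta> \<longrightarrow> H \<alpha> m = H \<beta> m \<circ> glue_aff Q \<alpha> \<beta> (coord \<alpha> m)) \<and>
      (\<exists>V. openin (glued Q) V \<and> m \<in> V \<and> (\<forall>m'\<in>V. H \<alpha> m' = H \<alpha> m))"
    by (elim exE)
  note H = bspec[OF bspec[OF H]]
  define G where "G \<alpha> x = H \<alpha> (incl Q \<alpha> x)" for \<alpha> x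
  have G_glue: "G \<alpha> x = G \<beta> (glue Q \<alpha> \<beta> x) \<circ> glue_aff Q \<alpha> \<beta> x"
    if "\<alpha> \<in> index Q" "\<beta> \<in> index Q" "x \<in> overlap Q \<alpha> \<beta>" for \<alpha> \<beta> x
  proof -
    have x: "x \<in> M \<alpha>" and gx: "glue Q \<alpha> \<beta> x \<in> M \<beta>"
      using that overlap_subset glue_mem by blast+
    have "incl Q \<alpha> x \<in> incl Q \<beta> ` M \<beta>" using incl_glue[OF that] gx by (metis imageI)
    then have "H \<alpha> (incl Q \<alpha> x) = H \<beta> (incl Q \<alpha> x) \<circ> glue_aff Q \<alpha> \<beta> (coord \<alpha> (incl Q \<alpha> x))"
      using H[THEN conjunct2, THEN conjunct1, OF that(1) imageI[OF x], rule_format, OF that(2)] by blast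
    then show ?thesis using coord_incl[OF that(1) x] incl_glue[OF that] by (simp add: G_def)
  qed
  \<comment> \<open>Local constancy of \<open>H \<alpha>\<close> pulls back along the continuous
    inclusion, and a component is connected.\<close>
  have G_const: "G \<alpha> x = G \<alpha> y" if \<alpha>: "\<alpha> \<in> index Q" and C: "C \<in> components (M \<alpha>)" and xy: "x \<in> C" "y \<in> C"
    for \<alpha> C x y
  proof (rule connected_local_const[OF in_components_connected[OF C] xy, of "G \<alpha>"], rule ballI)
    fix a assume a: "a \<in> C"
    have CM: "C \<subseteq> M \<alpha>" using C in_components_subset by blast
    with a have aM: "a \<in> M \<alpha>" by blast
    obtain V where V: "openin (glued Q) V" "incl Q \<alpha> a \<in> V" "\<forall>m'\<in>V. H \<alpha> m' = H \<alpha> (incl Q \<alpha> a)"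
      using H[THEN conjunct2, THEN conjunct2, OF \<alpha> imageI[OF aM]] by (elim exE conjE)
    have "continuous_map (top_of_set C) (glued Q) (incl Q \<alpha>)"
      using incl_continuous[OF \<alpha>] CM by (rule continuous_map_from_subtopology_mono)
    from eventually_U[OF this a V(1,2)] show "\<forall>\<^sub>F b in at a within C. G \<alpha> a = G \<alpha> b"
      by (rule eventually_mono) (use V(3) in \<open>simp add: G_def\<close>)
  qed
  have ex: "\<exists>\<alpha>x. fst \<alpha>x \<in> index Q \<and> snd \<alpha>x \<in> M (fst \<alpha>x) \<and> incl Q (fst \<alpha>x) (snd \<alpha>x) = incl Q \<alpha> x"
    if "\<alpha> \<in> index Q" "x \<in> M \<alpha>" for \<alpha> x
    using that by (intro exI[of _ "(\<alpha>, x)"]) simp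
  define ch where "ch m = (SOME \<alpha>x. fst \<alpha>x \<in> index Q \<and> snd \<alpha>x \<in> M (fst \<alpha>x) \<and> incl Q (fst \<alpha>x) (snd \<alpha>x) = m)" for m
  \<comment> \<open>\<open>X\<close> is read off an arbitrarily chosen representative;
    \<open>G_glue\<close>, evaluated at the point itself, shows that the choice does not
    matter.\<close>
  define X where "X m = G (fst (ch m)) (snd (ch m)) (snd (ch m))" for m
  have X: "X (incl Q \<alpha> x) = G \<alpha> x x" if \<alpha>: "\<alpha> \<in> index Q" "x \<in> M \<alpha>" for \<alpha> x
  proof -
    define \<beta> y where "\<beta> = fst (ch (incl Q \<alpha> x))" and "y = snd (ch (incl Q \<alpha> x))"
    have y: "\<beta> \<in> index Q" "y \<in> M \<beta>" "incl Q \<beta> y = incl Q \<alpha> x"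
      using someI_ex[OF ex[OF \<alpha>]] unfolding ch_def \<beta>_def y_def by auto
    then have "x \<in> overlap Q \<alpha> \<beta>" "y = glue Q \<alpha> \<beta> x" using incl_eq_iff[of \<alpha> \<beta> x y] \<alpha> by auto
    then have "G \<alpha> x x = G \<beta> y y" using G_glue[OF \<alpha>(1) y(1)] by (simp add: glue_def)
    then show ?thesis by (simp add: X_def \<beta>_def y_def)
  qed
  have "\<forall>\<alpha>\<in>index Q. \<forall>x\<in>M \<alpha>. affine_legendre (G \<alpha> x)"
    using H[THEN conjunct1] by (simp add: G_def)
  moreover have "\<forall>\<alpha>\<in>index Q. \<forall>C\<in>components (M \<alpha>). \<forall>x\<in>C. \<forall>y\<in>C. G \<alpha> x = G \<alpha> y"
    by (intro ballI) (rule G_const)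
  moreover have "\<forall>\<alpha>\<in>index Q. \<forall>\<beta>\<in>index Q. \<forall>x\<in>overlap Q \<alpha> \<beta>. G \<alpha> x = G \<beta> (glue Q \<alpha> \<beta> x) \<circ> glue_aff Q \<alpha> \<beta> x"
    by (intro ballI) (rule G_glue)
  moreover have "\<forall>\<alpha>\<in>index Q. \<forall>x\<in>M \<alpha>. X (incl Q \<alpha> x) = G \<alpha> x x"
    by (intro ballI) (rule X)
  ultimately have "developing_map Q X"
    unfolding developing_map_def by (intro exI[of _ G] conjI)
  then show ?thesis by blast
qed

end

section \<open>The Pythagorean relation\<close>

text \<open>Formulated at one parameter, with equality only near it, because the affine map changes
  from chart to chart. Injectivity keeps the direction nonzero and keeps the curve from becoming
  locally constant.\<close>

lemma locally_straight_affine: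
  assumes y: "locally_straight {t} y" and ev: "\<forall>\<^sub>F s in nhds t. y' s = A (y s) + b"
    and A: "linear A" "inj A"
  shows "locally_straight {t} y'"
  unfolding locally_straight_def
proof (intro ballI conjI)
  fix t' assume "t' \<in> {t}"
  then have t': "t' = t" by simp
  have yt: "y' t = A (y t) + b" using ev by (rule eventually_nhds_x_imp_x)
  from y obtain v where v: "v \<noteq> 0" "\<forall>\<^sub>F s in nhds t. \<exists>u. y s = y t + u *\<^sub>R v"
    unfolding locally_straight_def by blast
  have "A v \<noteq> 0" using A v(1) by (metis linear_injective_0)
  moreover have "\<forall>\<^sub>F s in nhds t. \<exists>u. y' s = y' t + u *\<^sub>R A v"
    using ev v(2)
  proof eventually_elim
    case (elim s)
    then obtain u where "y s = y t + u *\<^sub>R v" by blast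
    then have "y' s = y' t + u *\<^sub>R A v"
      using elim(1) yt by (simp add: linear_add[OF A(1)] linear_scale[OF A(1)])
    then show ?case by blast
  qed
  ultimately show "\<exists>v. v \<noteq> 0 \<and> (\<forall>\<^sub>F s in nhds t'. \<exists>u. y' s = y' t' + u *\<^sub>R v)"
    unfolding t' by blast
  show "\<not> (\<forall>\<^sub>F s in nhds t'. y' s = y' t')"
  proof
    assume "\<forall>\<^sub>F s in nhds t'. y' s = y' t'"
    with ev have "\<forall>\<^sub>F s in nhds t. y s = y t"
      unfolding t' by eventually_elim (use yt A(2) in \<open>simp add: inj_eq\<close>)
    with y show False unfolding locally_straight_def by blast
  qed
qed

lemma affine_legendre_parts:
  assumes "affine_legendre (F :: 'n::finite pt \<Rightarrow> 'n pt)"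
  shows "\<exists>A B b b'. (\<forall>x y. (A *v x) \<bullet> (B *v y) = x \<bullet> y) \<and> inj ((*v) A) \<and> inj ((*v) B) \<and>
    (\<forall>q. xc (F q) = A *v xc q + b) \<and> (\<forall>q. pc (F q) = B *v pc q + b')"
proof -
  obtain A B :: "real^'n^'n" and b c d where F: "transpose A ** B = mat 1"
    "F = (\<lambda>q. (A *v xc q + b, B *v (pc q + c), zc q + c \<bullet> xc q + d))"
    using assms unfolding affine_legendre_iff by blast
  have dot: "(A *v x) \<bullet> (B *v y) = x \<bullet> y" for x y
  proof -
    have "(A *v x) \<bullet> (B *v y) = (transpose A *v (B *v y)) \<bullet> x"
      unfolding transpose_dot by (rule inner_commute)
    also have "transpose A *v (B *v y) = y" unfolding matrix_vector_mul_assoc F(1) by simp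
    finally show ?thesis by (simp add: inner_commute)
  qed
  \<comment> \<open>\<open>A *v x\<close> determines all pairings of \<open>x\<close> by the duality
    identity, hence \<open>x\<close> itself; the same holds for \<open>B\<close>.\<close>
  have "inj ((*v) A)"
  proof (rule injI)
    fix x x' assume "A *v x = A *v x'"
    then have "x \<bullet> y = x' \<bullet> y" for y by (metis dot)
    then show "x = x'" by (metis vector_eq_rdot)
  qed
  moreover have "inj ((*v) B)"
  proof (rule injI)
    fix x x' assume "B *v x = B *v x'"
    then have "y \<bullet> x = y \<bullet> x'" for y by (metis dot)
    then show "x = x'" by (metis vector_eq_ldot)
  qed
  moreover have "\<forall>q. xc (F q) = A *v xc q + b" unfolding F(2) by (simp add: xc_def)
  moreover have "\<forall>q. pc (F q) = B *v pc q + B *v c" unfolding F(2) by (simp add: pc_def matrix_vector_right_distrib)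
  ultimately show ?thesis using dot by blast
qed

lemma locally_straight_pointwise: "locally_straight T y \<longleftrightarrow> (\<forall>t\<in>T. locally_straight {t} y)"
  by (simp add: locally_straight_def)

lemma divergence_add_iff:
  "divergence p r = divergence p q + divergence q r \<longleftrightarrow> (xc q - xc p) \<bullet> (pc r - pc q) = 0"
  by (auto simp: divergence_def zc'_def algebra_simps inner_diff_left inner_diff_right inner_commute)

lemma multiple_of_common_line:
  fixes v e :: "'v::real_vector"
  assumes "u *\<^sub>R v = u' *\<^sub>R e" "u *\<^sub>R v \<noteq> 0"
  shows "\<exists>\<kappa>. v = \<kappa> *\<^sub>R e"
proof -
  have "u \<noteq> 0" using assms(2) by auto
  have "(1/u) *\<^sub>R (u *\<^sub>R v) = (1/u) *\<^sub>R (u' *\<^sub>R e)" unfolding assms(1) ..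
  then show ?thesis using \<open>u \<noteq> 0\<close> by auto
qed

text \<open>\<open>C\<close> is the parameter component seen in one chart, \<open>I\<close> the
  whole interval. The developed curve is not constant near \<open>t\<close> and runs both on its own
  line and on the image of the chart line, so the directions are proportional. This carries a
  condition on chart directions to the entire curve.\<close>

lemma line_direction_affine:
  fixes y y' :: "real \<Rightarrow> 'v::real_normed_vector"
  assumes I: "connected I" "open I" "t \<in> I" and y': "locally_straight I y'"
    and C: "connected C" "open C" "t \<in> C" and y: "locally_straight C y"
    and A: "linear A" and eq: "\<And>s. s \<in> C \<Longrightarrow> y' s = A (y s) + b"
  obtains e v \<kappa> where "e \<noteq> 0" "\<forall>s\<in>C. \<exists>u. y s = y t + u *\<^sub>R e" "\<forall>s\<in>I. \<exists>u. y' s = y' t + u *\<^sub>R v" "v = \<kappa> *\<^sub>R A e"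
proof -
  obtain e where e: "e \<noteq> 0" "\<forall>s\<in>C. \<exists>u. y s = y t + u *\<^sub>R e"
    using locally_straight_imp_line[OF C(1,2) y C(3)] by blast
  obtain v where v: "\<forall>s\<in>I. \<exists>u. y' s = y' t + u *\<^sub>R v"
    using locally_straight_imp_line[OF I(1,2) y' I(3)] by blast
  have "\<exists>s\<in>C \<inter> I. y' s \<noteq> y' t"
  proof (rule ccontr)
    assume "\<not> ?thesis"
    moreover have "\<forall>\<^sub>F s in nhds t. s \<in> C \<inter> I"
      using C I by (intro eventually_nhds_in_open) auto
    ultimately have "\<forall>\<^sub>F s in nhds t. y' s = y' t" by (auto elim: eventually_mono)
    then show False using y' I(3) unfolding locally_straight_def by blast
  qed
  then obtain s u u' where s: "s \<in> C" "s \<in> I" "y' s \<noteq> y' t" "y' s = y' t + u *\<^sub>R v" "y s = y t + u' *\<^sub>R e"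
    using e(2) v by blast
  have "y' s = y' t + u' *\<^sub>R A e"
    using eq[OF s(1)] eq[OF C(3)] s(5) by (simp add: linear_add[OF A] linear_scale[OF A])
  with s(3,4) obtain \<kappa> where "v = \<kappa> *\<^sub>R A e"
    using multiple_of_common_line[of u v u' "A e"] by auto
  with e v show thesis using that by blast
qed

lemma inner_zero_of_lines:
  fixes a c q q' v w :: "'v::real_inner"
  assumes "a = q + u *\<^sub>R v" "c = q' + u' *\<^sub>R w" "v \<bullet> w = 0"
  shows "(q - a) \<bullet> (c - q') = 0"
  using assms by simp

lemma open_intervalD:
  assumes "open_interval I"
  shows "connected I" "open I"
  using assms by (simp_all add: open_interval_def is_interval_connected)

lemma legendre_pythagorean:
  fixes L :: "'n::finite pt set"
  assumes L: "legendre_submanifold L"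
    and ce: "e_curve L I ce" "joined_by I ce p q" and cm: "m_curve L J cm" "joined_by J cm q r"
    and orth: "strictly_orthogonal I ce J cm q"
  shows "divergence p r = divergence p q + divergence q r"
proof -
  have I: "connected I" "open I" and J: "connected J" "open J"
    using ce(1) cm(1) open_intervalD unfolding e_curve_def m_curve_def by blast+
  have e: "locally_straight I (\<lambda>t. xc (ce t))"
    using ce(1) e_straight[OF L I(2)] unfolding e_curve_def by blast
  have m: "locally_straight J (\<lambda>t. pc (cm t))"
    using cm(1) m_straight[OF L J(2)] unfolding m_curve_def by blast
  obtain t0 t1 where t: "t0 \<in> I" "t1 \<in> I" "ce t0 = p" "ce t1 = q" using ce(2) unfolding joined_by_def by blast
  obtain s0 s1 where s: "s0 \<in> J" "s1 \<in> J" "cm s0 = q" "cm s1 = r" using cm(2) unfolding joined_by_def by blast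
  obtain v where v: "v \<noteq> 0" "\<forall>t\<in>I. \<exists>u. xc (ce t) = xc (ce t1) + u *\<^sub>R v"
    using locally_straight_imp_line[OF I e t(2)] by blast
  obtain w where w: "w \<noteq> 0" "\<forall>t\<in>J. \<exists>u. pc (cm t) = pc (cm s0) + u *\<^sub>R w"
    using locally_straight_imp_line[OF J m s(1)] by blast
  have "v \<in> direction_vectors e_map I ce" "w \<in> direction_vectors m_map J cm"
    using v w unfolding direction_vectors_def e_map_def m_map_def by auto
  then have vw: "v \<bullet> w = 0" using orth unfolding strictly_orthogonal_def by blast
  obtain u u' where "xc p = xc q + u *\<^sub>R v" "pc r = pc q + u' *\<^sub>R w"
    using v(2) w(2) t s by metis
  then have "(xc q - xc p) \<bullet> (pc r - pc q) = 0"
    using vw by (rule inner_zero_of_lines)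
  then show ?thesis unfolding divergence_add_iff .
qed

section \<open>Developed curves and their lines\<close>

context quasi_hessian begin

lemma local_params_open:
  assumes \<alpha>: "\<alpha> \<in> index Q" and I: "open I" and c: "continuous_map (top_of_set I) (glued Q) c"
  shows "open (local_params Q \<alpha> I c)"
proof -
  have "openin (glued Q) (incl Q \<alpha> ` M \<alpha>)" using incl_open[OF \<alpha>] by simp
  from openin_continuous_map_preimage[OF c this]
  have "openin (top_of_set I) (local_params Q \<alpha> I c)" by (simp add: local_params_def)
  then show ?thesis using I openin_open_eq by blast
qed

lemma local_curve_mem:
  assumes "\<alpha> \<in> index Q" "t \<in> local_params Q \<alpha> I c"
  shows "local_curve Q \<alpha> c t \<in> M \<alpha>" "incl Q \<alpha> (local_curve Q \<alpha> c t) = c t"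
proof -
  have "c t \<in> incl Q \<alpha> ` M \<alpha>" using assms by (simp add: local_params_def)
  then show "local_curve Q \<alpha> c t \<in> M \<alpha>" "incl Q \<alpha> (local_curve Q \<alpha> c t) = c t"
    unfolding local_curve_def by (rule inv_into_into, rule f_inv_into_f)
qed

lemma local_curve_straight_e:
  assumes "qh_e_curve Q I c" "\<alpha> \<in> index Q"
  shows "locally_straight (local_params Q \<alpha> I c) (\<lambda>t. xc (local_curve Q \<alpha> c t))"
proof (rule e_straight[OF model_legendre[OF assms(2)]])
  show "open (local_params Q \<alpha> I c)"
    using assms local_params_open open_intervalD unfolding qh_e_curve_def by blast
  show "local_curve Q \<alpha> c ` local_params Q \<alpha> I c \<subseteq> M \<alpha>"
    using local_curve_mem[OF assms(2)] by blast
  show "straight_on e_map e_frame (local_params Q \<alpha> I c) (local_curve Q \<alpha> c)"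
    using assms unfolding qh_e_curve_def by blast
qed

lemma local_curve_straight_m:
  assumes "qh_m_curve Q I c" "\<alpha> \<in> index Q"
  shows "locally_straight (local_params Q \<alpha> I c) (\<lambda>t. pc (local_curve Q \<alpha> c t))"
proof (rule m_straight[OF model_legendre[OF assms(2)]])
  show "open (local_params Q \<alpha> I c)"
    using assms local_params_open open_intervalD unfolding qh_m_curve_def by blast
  show "local_curve Q \<alpha> c ` local_params Q \<alpha> I c \<subseteq> M \<alpha>"
    using local_curve_mem[OF assms(2)] by blast
  show "straight_on m_map m_frame (local_params Q \<alpha> I c) (local_curve Q \<alpha> c)"
    using assms unfolding qh_m_curve_def by blast
qed

text \<open>A connected set of parameters keeps the representative in one component of the local
  model, where \<open>G\<close> is a single equivalence.\<close>

lemma developed_curve: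
  assumes \<alpha>: "\<alpha> \<in> index Q"
    and G_const: "\<And>C x y. C \<in> components (M \<alpha>) \<Longrightarrow> x \<in> C \<Longrightarrow> y \<in> C \<Longrightarrow> G x = G y"
    and X: "\<And>x. x \<in> M \<alpha> \<Longrightarrow> X (incl Q \<alpha> x) = G x x"
    and smooth: "smooth_on (local_params Q \<alpha> I c) (local_curve Q \<alpha> c)"
    and t: "t \<in> local_params Q \<alpha> I c"
    and s: "s \<in> connected_component_set (local_params Q \<alpha> I c) t"
  shows "X (c s) = G (local_curve Q \<alpha> c t) (local_curve Q \<alpha> c s)"
proof -
  let ?T = "local_params Q \<alpha> I c" and ?l = "local_curve Q \<alpha> c"
  let ?C = "connected_component_set ?T t"
  have CT: "?C \<subseteq> ?T" by (rule connected_component_subset)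
  have "Ck_on 0 ?T ?l" using smooth unfolding smooth_on_def by blast
  then have "continuous_on ?C ?l" using CT continuous_on_subset by simp blast
  then have "connected (?l ` ?C)" by (intro connected_continuous_image) auto
  moreover have lM: "?l ` ?C \<subseteq> M \<alpha>" using CT local_curve_mem(1)[OF \<alpha>] by blast
  moreover have tC: "t \<in> ?C" using t by simp
  ultimately have sub: "?l ` ?C \<subseteq> connected_component_set (M \<alpha>) (?l t)"
    by (intro connected_component_maximal) auto
  have "connected_component_set (M \<alpha>) (?l t) \<in> components (M \<alpha>)"
    using lM tC by (intro componentsI) blast
  then have "G (?l s) = G (?l t)" by (rule G_const) (use sub s tC in blast)+
  moreover have "X (c s) = G (?l s) (?l s)"
    using X[of "?l s"] local_curve_mem[OF \<alpha>, of s I c] s CT by auto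
  ultimately show ?thesis by simp
qed

text \<open>The curve may cross many charts, but local straightness is a condition at each
  parameter, so any chart containing \<open>c t\<close> can be used there.\<close>

lemma developed_curve_locally_straight:
  fixes y' :: "real \<Rightarrow> real^'n"
  assumes I: "open I" and c: "continuous_map (top_of_set I) (glued Q) c"
    and local: "\<And>\<alpha> t. \<alpha> \<in> index Q \<Longrightarrow> t \<in> local_params Q \<alpha> I c \<Longrightarrow> \<exists>(y :: real \<Rightarrow> real^'n) A b.
      locally_straight {t} y \<and> linear A \<and> inj A \<and>
      (\<forall>s\<in>connected_component_set (local_params Q \<alpha> I c) t. y' s = A (y s) + (b :: real^'n))"
  shows "locally_straight I y'"
proof (subst locally_straight_pointwise, rule ballI)
  fix t assume t: "t \<in> I"
  then have "c t \<in> topspace (glued Q)" using c by (auto simp: continuous_map_def)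
  then obtain \<alpha> x where "\<alpha> \<in> index Q" "x \<in> M \<alpha>" "incl Q \<alpha> x = c t" by (rule glued_cover)
  then have \<alpha>: "\<alpha> \<in> index Q" "t \<in> local_params Q \<alpha> I c" using t by (force simp: local_params_def)+
  let ?C = "connected_component_set (local_params Q \<alpha> I c) t"
  obtain y :: "real \<Rightarrow> real^'n" and A b where y: "locally_straight {t} y" "linear A" "inj A" "\<forall>s\<in>?C. y' s = A (y s) + b"
    using local[OF \<alpha>] by (elim exE conjE)
  have "open ?C" using local_params_open[OF \<alpha>(1) I c] by (rule open_connected_component)
  moreover have "t \<in> ?C" using \<alpha>(2) by simp
  ultimately have "\<forall>\<^sub>F s in nhds t. s \<in> ?C" by (rule eventually_nhds_in_open)
  then have "\<forall>\<^sub>F s in nhds t. y' s = A (y s) + b" by (rule eventually_mono) (use y(4) in blast)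
  then show "locally_straight {t} y'" using locally_straight_affine[OF y(1) _ y(2,3)] by blast
qed

text \<open>Stated for an arbitrary \<open>X\<close>, so that it applies to whichever developing map
  the choice in \<open>canonical_divergence\<close> returns.\<close>

lemma developing_map_pythagorean:
  assumes dev: "developing_map Q X"
    and ce: "qh_e_curve Q I ce" "joined_by I ce p q" and cm: "qh_m_curve Q J cm" "joined_by J cm q r"
    and orth: "qh_strictly_orthogonal Q I ce J cm q"
  shows "divergence (X p) (X r) = divergence (X p) (X q) + divergence (X q) (X r)"
proof -
  have I: "connected I" "open I" and J: "connected J" "open J"
    and cI: "continuous_map (top_of_set I) (glued Q) ce" and cJ: "continuous_map (top_of_set J) (glued Q) cm"
    using ce(1) cm(1) open_intervalD unfolding qh_e_curve_def qh_m_curve_def by blast+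
  have smooth_e: "smooth_on (local_params Q \<alpha> I ce) (local_curve Q \<alpha> ce)" if "\<alpha> \<in> index Q" for \<alpha>
    using ce(1) that unfolding qh_e_curve_def straight_on_def by blast
  have smooth_m: "smooth_on (local_params Q \<alpha> J cm) (local_curve Q \<alpha> cm)" if "\<alpha> \<in> index Q" for \<alpha>
    using cm(1) that unfolding qh_m_curve_def straight_on_def by blast
  obtain G where G: "\<forall>\<alpha>\<in>index Q. \<forall>x\<in>M \<alpha>. affine_legendre (G \<alpha> x)"
     "\<forall>\<alpha>\<in>index Q. \<forall>C\<in>components (M \<alpha>). \<forall>x\<in>C. \<forall>y\<in>C. G \<alpha> x = G \<alpha> y"
     "\<forall>\<alpha>\<in>index Q. \<forall>x\<in>M \<alpha>. X (incl Q \<alpha> x) = G \<alpha> x x"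
    using dev unfolding developing_map_def by (elim exE conjE)
  have G_const: "G \<alpha> x = G \<alpha> y" if "\<alpha> \<in> index Q" "C \<in> components (M \<alpha>)" "x \<in> C" "y \<in> C" for \<alpha> C x y
    using G(2) that by blast
  have X: "X (incl Q \<alpha> x) = G \<alpha> x x" if "\<alpha> \<in> index Q" "x \<in> M \<alpha>" for \<alpha> x
    using G(3) that by blast
  have dev_e: "X (ce s) = G \<alpha> (local_curve Q \<alpha> ce t) (local_curve Q \<alpha> ce s)"
    if "\<alpha> \<in> index Q" "t \<in> local_params Q \<alpha> I ce" "s \<in> connected_component_set (local_params Q \<alpha> I ce) t" for \<alpha> t s
    by (rule developed_curve[OF that(1) G_const[OF that(1)] X[OF that(1)] smooth_e[OF that(1)] that(2,3)])
  have dev_m: "X (cm s) = G \<alpha> (local_curve Q \<alpha> cm t) (local_curve Q \<alpha> cm s)"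
    if "\<alpha> \<in> index Q" "t \<in> local_params Q \<alpha> J cm" "s \<in> connected_component_set (local_params Q \<alpha> J cm) t" for \<alpha> t s
    by (rule developed_curve[OF that(1) G_const[OF that(1)] X[OF that(1)] smooth_m[OF that(1)] that(2,3)])
  have aff: "affine_legendre (G \<alpha> (local_curve Q \<alpha> c t))" if "\<alpha> \<in> index Q" "t \<in> local_params Q \<alpha> K c" for \<alpha> t K c
    using G(1) that local_curve_mem(1)[OF that] by blast
  have e: "locally_straight I (\<lambda>t. xc (X (ce t)))"
  proof (rule developed_curve_locally_straight[OF I(2) cI])
    fix \<alpha> t assume t: "\<alpha> \<in> index Q" "t \<in> local_params Q \<alpha> I ce"
    obtain A B b b' where A: "inj ((*v) A)" "\<And>q. xc (G \<alpha> (local_curve Q \<alpha> ce t) q) = A *v xc q + b"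
      using affine_legendre_parts[OF aff[OF t]] by metis
    show "\<exists>(y :: real \<Rightarrow> real^'n) A b. locally_straight {t} y \<and> linear A \<and> inj A \<and>
      (\<forall>s\<in>connected_component_set (local_params Q \<alpha> I ce) t. xc (X (ce s)) = A (y s) + b)"
    proof (intro exI[of _ "\<lambda>t. xc (local_curve Q \<alpha> ce t)"] exI[of _ "(*v) A"] exI[of _ b] conjI ballI)
      show "locally_straight {t} (\<lambda>t. xc (local_curve Q \<alpha> ce t))"
        using local_curve_straight_e[OF ce(1) t(1)] t(2) locally_straight_pointwise by blast
      fix s assume s: "s \<in> connected_component_set (local_params Q \<alpha> I ce) t"
      show "xc (X (ce s)) = A *v xc (local_curve Q \<alpha> ce s) + b"
        by (simp only: dev_e[OF t s] A(2))
    qed (use A in auto)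
  qed
  have m: "locally_straight J (\<lambda>t. pc (X (cm t)))"
  proof (rule developed_curve_locally_straight[OF J(2) cJ])
    fix \<alpha> t assume t: "\<alpha> \<in> index Q" "t \<in> local_params Q \<alpha> J cm"
    obtain A B b b' where A: "inj ((*v) B)" "\<And>q. pc (G \<alpha> (local_curve Q \<alpha> cm t) q) = B *v pc q + b'"
      using affine_legendre_parts[OF aff[OF t]] by metis
    show "\<exists>(y :: real \<Rightarrow> real^'n) A b. locally_straight {t} y \<and> linear A \<and> inj A \<and>
      (\<forall>s\<in>connected_component_set (local_params Q \<alpha> J cm) t. pc (X (cm s)) = A (y s) + b)"
    proof (intro exI[of _ "\<lambda>t. pc (local_curve Q \<alpha> cm t)"] exI[of _ "(*v) B"] exI[of _ b'] conjI ballI)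
      show "locally_straight {t} (\<lambda>t. pc (local_curve Q \<alpha> cm t))"
        using local_curve_straight_m[OF cm(1) t(1)] t(2) locally_straight_pointwise by blast
      fix s assume s: "s \<in> connected_component_set (local_params Q \<alpha> J cm) t"
      show "pc (X (cm s)) = B *v pc (local_curve Q \<alpha> cm s) + b'"
        by (simp only: dev_m[OF t s] A(2))
    qed (use A in auto)
  qed
  obtain \<alpha> t s where \<alpha>: "\<alpha> \<in> index Q" and t: "t \<in> local_params Q \<alpha> I ce" "ce t = q"
    and s: "s \<in> local_params Q \<alpha> J cm" "cm s = q"
    and dir: "\<forall>e\<in>direction_vectors e_map (connected_component_set (local_params Q \<alpha> I ce) t) (local_curve Q \<alpha> ce).
      \<forall>m\<in>direction_vectors m_map (connected_component_set (local_params Q \<alpha> J cm) s) (local_curve Q \<alpha> cm).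
        e \<bullet> m = 0"
    using orth unfolding qh_strictly_orthogonal_def by (elim bexE conjE)
  let ?C = "connected_component_set (local_params Q \<alpha> I ce) t"
  let ?D = "connected_component_set (local_params Q \<alpha> J cm) s"
  let ?F = "G \<alpha> (local_curve Q \<alpha> ce t)"
  \<comment> \<open>Both curves have the same preimage of \<open>q\<close> in the model, so one
    equivalence develops them there. Only then are \<open>A\<close> and \<open>B\<close> below dual
    to each other.\<close>
  have F_eq: "G \<alpha> (local_curve Q \<alpha> cm s) = ?F" using t s by (simp add: local_curve_def)
  obtain A B b b' where AB: "\<And>x y. (A *v x) \<bullet> (B *v y) = x \<bullet> y"
    "\<And>q. xc (?F q) = A *v xc q + b" "\<And>q. pc (?F q) = B *v pc q + b'"
    using affine_legendre_parts[OF aff[OF \<alpha> t(1)]] by metis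
  have CI: "?C \<subseteq> local_params Q \<alpha> I ce" and DJ: "?D \<subseteq> local_params Q \<alpha> J cm"
    by (rule connected_component_subset)+
  have tI: "t \<in> I" "s \<in> J" using t s by (simp_all add: local_params_def)
  have C: "connected ?C" "open ?C" "t \<in> ?C" "connected ?D" "open ?D" "s \<in> ?D"
    using open_connected_component[OF local_params_open[OF \<alpha> I(2) cI]]
      open_connected_component[OF local_params_open[OF \<alpha> J(2) cJ]] t s by auto
  have eC: "locally_straight ?C (\<lambda>t. xc (local_curve Q \<alpha> ce t))"
    using local_curve_straight_e[OF ce(1) \<alpha>] CI unfolding locally_straight_def by blast
  have mD: "locally_straight ?D (\<lambda>t. pc (local_curve Q \<alpha> cm t))"
    using local_curve_straight_m[OF cm(1) \<alpha>] DJ unfolding locally_straight_def by blast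
  have Xe: "xc (X (ce u)) = A *v xc (local_curve Q \<alpha> ce u) + b" if "u \<in> ?C" for u
    by (simp only: dev_e[OF \<alpha> t(1) that] AB)
  have Xm: "pc (X (cm u)) = B *v pc (local_curve Q \<alpha> cm u) + b'" if "u \<in> ?D" for u
    by (simp only: dev_m[OF \<alpha> s(1) that] F_eq AB)
  obtain e1 v \<kappa> where v: "e1 \<noteq> 0" "\<forall>u\<in>?C. \<exists>a. xc (local_curve Q \<alpha> ce u) = xc (local_curve Q \<alpha> ce t) + a *\<^sub>R e1"
    "\<forall>u\<in>I. \<exists>a. xc (X (ce u)) = xc (X (ce t)) + a *\<^sub>R v" "v = \<kappa> *\<^sub>R (A *v e1)"
    by (rule line_direction_affine[OF I tI(1) e C(1-3) eC matrix_vector_mul_linear Xe])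
  obtain m1 w \<mu> where w: "m1 \<noteq> 0" "\<forall>u\<in>?D. \<exists>a. pc (local_curve Q \<alpha> cm u) = pc (local_curve Q \<alpha> cm s) + a *\<^sub>R m1"
    "\<forall>u\<in>J. \<exists>a. pc (X (cm u)) = pc (X (cm s)) + a *\<^sub>R w" "w = \<mu> *\<^sub>R (B *v m1)"
    by (rule line_direction_affine[OF J tI(2) m C(4-6) mD matrix_vector_mul_linear Xm])
  have "e1 \<in> direction_vectors e_map ?C (local_curve Q \<alpha> ce)" "m1 \<in> direction_vectors m_map ?D (local_curve Q \<alpha> cm)"
    using v(1,2) w(1,2) unfolding direction_vectors_def e_map_def m_map_def fst_conv by blast+
  then have "e1 \<bullet> m1 = 0" using dir by blast
  then have vw: "v \<bullet> w = 0" using v(4) w(4) AB(1) by simp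
  obtain t0 t1 where p: "t0 \<in> I" "ce t0 = p" using ce(2) unfolding joined_by_def by blast
  obtain s0 s1 where r: "s1 \<in> J" "cm s1 = r" using cm(2) unfolding joined_by_def by blast
  obtain a where a: "xc (X p) = xc (X q) + a *\<^sub>R v" using v(3) p t(2) by blast
  obtain a' where a': "pc (X r) = pc (X q) + a' *\<^sub>R w" using w(3) r s(2) by blast
  have "(xc (X q) - xc (X p)) \<bullet> (pc (X r) - pc (X q)) = 0"
    by (rule inner_zero_of_lines[OF a a' vw])
  then show ?thesis unfolding divergence_add_iff .
qed

end

theorem theorem4p7:
  fixes L :: "'n::finite pt set" and Q :: "('i, 'n, 'm) qh_data"
  shows
    "(legendre_submanifold L \<longrightarrow>
       (\<forall>p\<in>L. \<forall>q\<in>L. \<forall>r\<in>L. \<forall>I J ce cm.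
          distinct [p, q, r] \<and>
          e_curve L I ce \<and> joined_by I ce p q \<and>
          m_curve L J cm \<and> joined_by J cm q r \<and>
          strictly_orthogonal I ce J cm q \<longrightarrow>
          divergence p r = divergence p q + divergence q r)) \<and>
     (quasi_hessian_manifold Q \<and> connected_space (glued Q) \<and> simply_connected_space (glued Q) \<longrightarrow>
       (\<forall>p\<in>topspace (glued Q). \<forall>q\<in>topspace (glued Q). \<forall>r\<in>topspace (glued Q). \<forall>I J ce cm.
          distinct [p, q, r] \<and>
          qh_e_curve Q I ce \<and> joined_by I ce p q \<and>
          qh_m_curve Q J cm \<and> joined_by J cm q r \<and>
          qh_strictly_orthogonal Q I ce J cm q \<longrightarrow>
          canonical_divergence Q p r = canonical_divergence Q p q + canonical_divergence Q q r))"
proof (intro conjI impI ballI allI; elim conjE)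
  fix p q r I J ce cm
  assume "legendre_submanifold L" "e_curve L I ce" "joined_by I ce p q" "m_curve L J cm" "joined_by J cm q r"
    "strictly_orthogonal I ce J cm q"
  then show "divergence p r = divergence p q + divergence q r" by (rule legendre_pythagorean)
next
  fix p q r I J ce cm
  assume M: "quasi_hessian_manifold Q" "connected_space (glued Q)" "simply_connected_space (glued Q)"
    and curves: "qh_e_curve Q I ce" "joined_by I ce p q" "qh_m_curve Q J cm" "joined_by J cm q r"
    "qh_strictly_orthogonal Q I ce J cm q"
  interpret quasi_hessian Q using M(1) by unfold_locales
  have "developing_map Q (SOME X. developing_map Q X)"
    using developing_map_exists[OF M(2,3)] by (rule someI_ex)
  then show "canonical_divergence Q p r = canonical_divergence Q p q + canonical_divergence Q q r"
    unfolding canonical_divergence_def Let_def using curves by (rule developing_map_pythagorean)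
qed

end
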